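(* Let $k\ge 2$ and $d$ be positive integers. Suppose there exists an algorithm for $[\mathsf{Static}]\mathsf{(k-1)D\;LWS}_{n,N,d}$ with running time $O(N^{2-\varepsilon}\cdot n^{k-2})$ for some $\varepsilon>0$. Then there exists an algorithm for $[\mathsf{Static}]\mathsf{kD\;LWS}_{n,N,d}$ with running time $O(N^{2-\delta}\cdot n^{k-1})$ for some $\delta>0$.
   Context: Generalized inner product: $\langle x_1,\ldots,x_m\rangle=\sum_{s=1}^d\prod_{t=1}^m x_t[s]$. A tensor $w:[n]^{m+1}\to\mathbb{R}$ has rank $d$ if there are vectors $x_{t,i}\in\mathbb{R}^d$ with $w[i_1,\ldots,i_{m+1}]=\langle x_{1,i_1},\ldots,x_{m+1,i_{m+1}}\rangle$. For a positive integer $m$, the $\mathsf{mD\;LWS}$ table for tensors $w_1,\ldots,w_m:[n]^{m+1}\to\{-W,\ldots,W,\infty\}$ is $T:[n]^m\to\mathbb{Z}\cup\{\infty\}$ with $T[1,\ldots,1]=0$ and otherwise $T[j_1,\ldots,j_m]=\min_{1\le\ell\le m}\min_{1\le i_\ell<j_\ell}\bigl(T[j_1,\ldots,j_{\ell-1},i_\ell,j_{\ell+1},\ldots,j_m]+w_\ell[j_1,\ldots,j_m,i_\ell]\bigr)$. For integers $\alpha\le\beta$ let $D_{\alpha,\beta}=\{(i_1,\ldots,i_m)\in[n]^m:\alpha\le i_1+\cdots+i_m<\beta\}$. $[\mathsf{Static}]\mathsf{mD\;LWS}_{n,N,d}$: given $w_1,\ldots,w_m$ each of rank $d$ (given by their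 vectors), integers $a,N$, and the correct values $T[i]$ for all $i\in D_{a,a+N}$, output for every $(j_1,\ldots,j_m)\in D_{a+N,a+2N}$ the value $T'[j_1,\ldots,j_m]=\min_{1\le\ell\le m}\min_{a-J_\ell\le i_\ell<a+N-J_\ell}\bigl(T[j_1,\ldots,j_{\ell-1},i_\ell,j_{\ell+1},\ldots,j_m]+w_\ell[j_1,\ldots,j_m,i_\ell]\bigr)$, where $J_\ell=\sum_{t\neq\ell}j_t$. *)

theory Defs
  imports Complex_Main "HOL-Library.Extended_Real"
begin

section \<open>Model of computation\<close>

text \<open>
  A unit-cost real RAM. A machine has integer memory, consisting of machine words, and real memory.
  Both are divided into arrays; array names are part of the program text (so a program uses finitely
  many of them), positions inside an array are computed at run time. There is no operation that turns
  a real into an integer, and the only constants are integers.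

  Words are bounded: an integer operation whose result exceeds the word bound \<open>B\<close> in absolute value
  is an error, i.e. the program has no execution. Division by 0 yields 0, as everywhere in HOL.
\<close>

datatype iexp =
    IConst int
  | ILoad nat iexp
  | IAdd iexp iexp
  | ISub iexp iexp
  | IMul iexp iexp
  | IDiv iexp iexp
  | IMod iexp iexp

datatype rexp =
    ROfInt iexp
  | RLoad nat iexp
  | RAdd rexp rexp
  | RSub rexp rexp
  | RMul rexp rexp
  | RDiv rexp rexp

datatype bexp =
    ILess iexp iexp
  | RLess rexp rexp
  | BNot bexp
  | BAnd bexp bexp

datatype com =
    Skip
  | IStore nat iexp iexp
  | RStore nat iexp rexp
  | Seq com com
  | Cond bexp com com
  | While bexp com

record state =
  imem :: "nat \<Rightarrow> int \<Rightarrow> int"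
  rmem :: "nat \<Rightarrow> int \<Rightarrow> real"

primrec ival :: "state \<Rightarrow> iexp \<Rightarrow> int" where
  "ival s (IConst v) = v"
| "ival s (ILoad r e) = imem s r (ival s e)"
| "ival s (IAdd e f) = ival s e + ival s f"
| "ival s (ISub e f) = ival s e - ival s f"
| "ival s (IMul e f) = ival s e * ival s f"
| "ival s (IDiv e f) = ival s e div ival s f"
| "ival s (IMod e f) = ival s e mod ival s f"

primrec rval :: "state \<Rightarrow> rexp \<Rightarrow> real" where
  "rval s (ROfInt e) = real_of_int (ival s e)"
| "rval s (RLoad r e) = rmem s r (ival s e)"
| "rval s (RAdd e f) = rval s e + rval s f"
| "rval s (RSub e f) = rval s e - rval s f"
| "rval s (RMul e f) = rval s e * rval s f"
| "rval s (RDiv e f) = rval s e / rval s f"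

primrec bval :: "state \<Rightarrow> bexp \<Rightarrow> bool" where
  "bval s (ILess e f) \<longleftrightarrow> ival s e < ival s f"
| "bval s (RLess e f) \<longleftrightarrow> rval s e < rval s f"
| "bval s (BNot b) \<longleftrightarrow> \<not> bval s b"
| "bval s (BAnd b c) \<longleftrightarrow> bval s b \<and> bval s c"

text \<open>\<open>iok\<close>, \<open>rok\<close>, \<open>bok\<close>: no integer subexpression leaves the range of words.\<close>

primrec iok :: "int \<Rightarrow> state \<Rightarrow> iexp \<Rightarrow> bool" where
  "iok B s (IConst v) \<longleftrightarrow> \<bar>v\<bar> \<le> B"
| "iok B s (ILoad r e) \<longleftrightarrow> iok B s e \<and> \<bar>ival s (ILoad r e)\<bar> \<le> B"
| "iok B s (IAdd e f) \<longleftrightarrow> iok B s e \<and> iok B s f \<and> \<bar>ival s (IAdd e f)\<bar> \<le> B"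
| "iok B s (ISub e f) \<longleftrightarrow> iok B s e \<and> iok B s f \<and> \<bar>ival s (ISub e f)\<bar> \<le> B"
| "iok B s (IMul e f) \<longleftrightarrow> iok B s e \<and> iok B s f \<and> \<bar>ival s (IMul e f)\<bar> \<le> B"
| "iok B s (IDiv e f) \<longleftrightarrow> iok B s e \<and> iok B s f \<and> \<bar>ival s (IDiv e f)\<bar> \<le> B"
| "iok B s (IMod e f) \<longleftrightarrow> iok B s e \<and> iok B s f \<and> \<bar>ival s (IMod e f)\<bar> \<le> B"

primrec rok :: "int \<Rightarrow> state \<Rightarrow> rexp \<Rightarrow> bool" where
  "rok B s (ROfInt e) \<longleftrightarrow> iok B s e"
| "rok B s (RLoad r e) \<longleftrightarrow> iok B s e"
| "rok B s (RAdd e f) \<longleftrightarrow> rok B s e \<and> rok B s f"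
| "rok B s (RSub e f) \<longleftrightarrow> rok B s e \<and> rok B s f"
| "rok B s (RMul e f) \<longleftrightarrow> rok B s e \<and> rok B s f"
| "rok B s (RDiv e f) \<longleftrightarrow> rok B s e \<and> rok B s f"

primrec bok :: "int \<Rightarrow> state \<Rightarrow> bexp \<Rightarrow> bool" where
  "bok B s (ILess e f) \<longleftrightarrow> iok B s e \<and> iok B s f"
| "bok B s (RLess e f) \<longleftrightarrow> rok B s e \<and> rok B s f"
| "bok B s (BNot b) \<longleftrightarrow> bok B s b"
| "bok B s (BAnd b c) \<longleftrightarrow> bok B s b \<and> bok B s c"

definition istore :: "nat \<Rightarrow> int \<Rightarrow> int \<Rightarrow> state \<Rightarrow> state" where
  "istore r i v s = s\<lparr>imem := (imem s)(r := (imem s r)(i := v))\<rparr>"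

definition rstore :: "nat \<Rightarrow> int \<Rightarrow> real \<Rightarrow> state \<Rightarrow> state" where
  "rstore r i v s = s\<lparr>rmem := (rmem s)(r := (rmem s r)(i := v))\<rparr>"

text \<open>
  \<open>exec B c s t s'\<close>: with word bound \<open>B\<close>, program \<open>c\<close> started in \<open>s\<close> halts in \<open>s'\<close> after \<open>t\<close> steps.
  Each store and each test is one step. Expressions have constant size, so this counts machine
  operations up to a constant factor depending on the program.
\<close>

inductive exec :: "int \<Rightarrow> com \<Rightarrow> state \<Rightarrow> nat \<Rightarrow> state \<Rightarrow> bool" for B :: int where
  Skip: "exec B Skip s 1 s"
| IStore: "iok B s e \<Longrightarrow> iok B s f \<Longrightarrow>
    exec B (IStore r e f) s 1 (istore r (ival s e) (ival s f) s)"
| RStore: "iok B s e \<Longrightarrow> rok B s f \<Longrightarrow>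
    exec B (RStore r e f) s 1 (rstore r (ival s e) (rval s f) s)"
| Seq: "exec B c1 s t1 s1 \<Longrightarrow> exec B c2 s1 t2 s2 \<Longrightarrow> exec B (Seq c1 c2) s (t1 + t2) s2"
| CondTrue: "bok B s b \<Longrightarrow> bval s b \<Longrightarrow> exec B c1 s t s1 \<Longrightarrow> exec B (Cond b c1 c2) s (t + 1) s1"
| CondFalse: "bok B s b \<Longrightarrow> \<not> bval s b \<Longrightarrow> exec B c2 s t s1 \<Longrightarrow> exec B (Cond b c1 c2) s (t + 1) s1"
| WhileFalse: "bok B s b \<Longrightarrow> \<not> bval s b \<Longrightarrow> exec B (While b c) s 1 s"
| WhileTrue: "bok B s b \<Longrightarrow> bval s b \<Longrightarrow> exec B c s t1 s1 \<Longrightarrow> exec B (While b c) s1 t2 s2 \<Longrightarrow>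
    exec B (While b c) s (t1 + t2 + 1) s2"

inductive_cases Skip_E: "exec B Skip s t s'"
inductive_cases IStore_E: "exec B (IStore r e f) s t s'"
inductive_cases RStore_E: "exec B (RStore r e f) s t s'"
inductive_cases Seq_E: "exec B (Seq c1 c2) s t s'"
inductive_cases Cond_E: "exec B (Cond b c1 c2) s t s'"
inductive_cases While_E: "exec B (While b c) s t s'"

lemma exec_deterministic:
  "exec B c s t s' \<Longrightarrow> exec B c s u s'' \<Longrightarrow> u = t \<and> s'' = s'"
proof (induction arbitrary: u s'' rule: exec.induct)
  case (Skip s) then show ?case by (auto elim: Skip_E)
next
  case (IStore s e f r) then show ?case by (auto elim: IStore_E)
next
  case (RStore s e f r) then show ?case by (auto elim: RStore_E)
next
  case (Seq c1 s t1 s1 c2 t2 s2)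
  from Seq.prems show ?case by (rule Seq_E) (metis Seq.IH)
next
  case (CondTrue s b c1 t s1 c2)
  from CondTrue.prems show ?case by (rule Cond_E) (metis CondTrue.IH Suc_eq_plus1, metis CondTrue.hyps)
next
  case (CondFalse s b c2 t s1 c1)
  from CondFalse.prems show ?case by (rule Cond_E) (metis CondFalse.hyps, metis CondFalse.IH Suc_eq_plus1)
next
  case (WhileFalse s b c)
  from WhileFalse.prems show ?case by (rule While_E) (simp, metis WhileFalse.hyps)
next
  case (WhileTrue s b c t1 s1 t2 s2)
  from WhileTrue.prems show ?case by (rule While_E) (metis WhileTrue.hyps, metis WhileTrue.IH Suc_eq_plus1)
qed


section \<open>The static multi-dimensional LWS problem\<close>

text \<open>
  Tuples are lists. Their entries lie in \<open>{1..n}\<close> as usual, but their positions (the \<open>l\<close> and \<open>t\<close>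
  below) and the components of a vector are counted from 0.
\<close>

definition cube :: "nat \<Rightarrow> nat \<Rightarrow> nat list set" where
  "cube n m = {js. length js = m \<and> set js \<subseteq> {1..n}}"

definition band :: "nat \<Rightarrow> nat \<Rightarrow> int \<Rightarrow> int \<Rightarrow> nat list set" where
  "band n m \<alpha> \<beta> = {js \<in> cube n m. \<alpha> \<le> int (sum_list js) \<and> int (sum_list js) < \<beta>}"

definition gen_inner :: "nat \<Rightarrow> (nat \<Rightarrow> real) list \<Rightarrow> real" where
  "gen_inner d xs = (\<Sum>s<d. \<Prod>x\<leftarrow>xs. x s)"

text \<open>The vectors \<open>x t i\<close> witness that \<open>w : [n]\<^sup>q \<rightarrow> \<real>\<close> has rank \<open>d\<close>.\<close>

definition rank_witness ::
    "nat \<Rightarrow> nat \<Rightarrow> nat \<Rightarrow> (nat list \<Rightarrow> real) \<Rightarrow> (nat \<Rightarrow> nat \<Rightarrow> nat \<Rightarrow> real) \<Rightarrow> bool" where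
  "rank_witness n q d w x \<longleftrightarrow> (\<forall>js \<in> cube n q. w js = gen_inner d (map (\<lambda>t. x t (js ! t)) [0..<q]))"

text \<open>
  The required value \<open>T'[j\<^sub>1, \<dots>, j\<^sub>m]\<close>. The inner minimum ranges over those \<open>i\<close> for which the table has
  an entry, i.e. \<open>i \<in> [n]\<close>. The minimum of the empty set is \<open>\<infinity>\<close>.
\<close>

definition static_value ::
    "nat \<Rightarrow> nat \<Rightarrow> nat \<Rightarrow> int \<Rightarrow> (nat \<Rightarrow> nat list \<Rightarrow> int) \<Rightarrow> (nat list \<Rightarrow> ereal) \<Rightarrow> nat list \<Rightarrow> ereal" where
  "static_value m n N a w T js =
    (INF l\<in>{..<m}. let J = (\<Sum>t\<in>{..<m} - {l}. int (js ! t)) in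
      INF i\<in>{i \<in> {1..n}. a - J \<le> int i \<and> int i < a + int N - J}.
        T (js[l := i]) + ereal (real_of_int (w l (js @ [i]))))"

text \<open>
  Inputs of the problem in dimension \<open>m\<close> and rank \<open>d\<close>; \<open>x l\<close> are the vectors of \<open>w l\<close>. A rank
  decomposition has real values, so the weights, which are taken from \<open>{-W, \<dots>, W, \<infinity>}\<close>, are integers
  (as \<open>[n]\<^sup>m\<^sup>+\<^sup>1\<close> is finite, a bound \<open>W\<close> always exists).

  The table values on the band \<open>a, \<dots>, a + N - 1\<close> are given as data. The problem is a function of these
  values alone, and \<open>T\<close> is an arbitrary function to \<open>\<int> \<union> {\<infinity>}\<close>; in particular it may be the LWS table
  of \<open>w\<close>, or, as when coordinates are fixed, the restriction of a higher-dimensional LWS table, which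
  satisfies no LWS recurrence of its own.
\<close>

definition static_instance ::
    "nat \<Rightarrow> nat \<Rightarrow> nat \<Rightarrow> nat \<Rightarrow> int \<Rightarrow> (nat \<Rightarrow> nat list \<Rightarrow> int) \<Rightarrow>
     (nat \<Rightarrow> nat \<Rightarrow> nat \<Rightarrow> nat \<Rightarrow> real) \<Rightarrow> (nat list \<Rightarrow> ereal) \<Rightarrow> bool" where
  "static_instance m d n N a w x T \<longleftrightarrow>
    1 \<le> n \<and> 1 \<le> N \<and>
    (\<forall>l<m. rank_witness n (m + 1) d (\<lambda>js. real_of_int (w l js)) (x l)) \<and>
    (\<forall>js \<in> band n m a (a + int N). T js = \<infinity> \<or> (\<exists>z::int. T js = ereal (real_of_int z)))"


section \<open>Algorithms for the static problem\<close>

text \<open>Row-major addresses.\<close>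

definition vec_addr :: "nat \<Rightarrow> nat \<Rightarrow> nat \<Rightarrow> nat \<Rightarrow> nat \<Rightarrow> nat \<Rightarrow> nat \<Rightarrow> int" where
  "vec_addr m d n l t i s = int (((l * (m + 1) + t) * (n + 1) + i) * d + s)"

definition tab_addr :: "nat \<Rightarrow> nat list \<Rightarrow> int" where
  "tab_addr n js = int (foldl (\<lambda>z j. z * (n + 1) + j) 0 js)"

text \<open>An element of \<open>\<int> \<union> {\<infinity>}\<close> is stored as an integer flag and a real.\<close>

definition holds :: "state \<Rightarrow> nat \<Rightarrow> int \<Rightarrow> ereal \<Rightarrow> bool" where
  "holds s r p v \<longleftrightarrow>
    imem s r p = 0 \<and> v = ereal (rmem s r p) \<or> imem s r p = 1 \<and> v = \<infinity>"

text \<open>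
  Input format: \<open>n\<close>, \<open>N\<close>, \<open>a\<close> in integer array 0, the vectors in real array 0, and \<open>T\<close> on the band in
  arrays 1. The output goes to arrays 2. Memory not mentioned here is uninitialised: a program has to
  work for any initial content (of words).
\<close>

definition static_input ::
    "nat \<Rightarrow> nat \<Rightarrow> nat \<Rightarrow> nat \<Rightarrow> int \<Rightarrow> (nat \<Rightarrow> nat \<Rightarrow> nat \<Rightarrow> nat \<Rightarrow> real) \<Rightarrow> (nat list \<Rightarrow> ereal) \<Rightarrow>
     state \<Rightarrow> bool" where
  "static_input m d n N a x T s \<longleftrightarrow>
    imem s 0 0 = int n \<and> imem s 0 1 = int N \<and> imem s 0 2 = a \<and>
    (\<forall>l<m. \<forall>t<m + 1. \<forall>i\<in>{1..n}. \<forall>q<d. rmem s 0 (vec_addr m d n l t i q) = x l t i q) \<and>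
    (\<forall>js \<in> band n m a (a + int N). holds s 1 (tab_addr n js) (T js))"

definition static_output ::
    "nat \<Rightarrow> nat \<Rightarrow> nat \<Rightarrow> int \<Rightarrow> (nat \<Rightarrow> nat list \<Rightarrow> int) \<Rightarrow> (nat list \<Rightarrow> ereal) \<Rightarrow> state \<Rightarrow> bool" where
  "static_output m n N a w T s \<longleftrightarrow>
    (\<forall>js \<in> band n m (a + int N) (a + 2 * int N).
      holds s 2 (tab_addr n js) (static_value m n N a w T js))"

text \<open>
  \<open>P\<close> solves the static problem in dimension \<open>m\<close> and rank \<open>d\<close> in time \<open>O(f n N)\<close>, on machines whose
  words have at least \<open>c \<cdot> log (n + N + |a| + 2)\<close> bits, for some constant \<open>c\<close>.
\<close>

definition solves_static :: "nat \<Rightarrow> nat \<Rightarrow> com \<Rightarrow> (nat \<Rightarrow> nat \<Rightarrow> real) \<Rightarrow> bool" where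
  "solves_static m d P f \<longleftrightarrow>
    (\<exists>(c::nat) (C::real). \<forall>n N a w x T B s.
      static_instance m d n N a w x T \<longrightarrow>
      (int n + int N + \<bar>a\<bar> + 2) ^ c \<le> B \<longrightarrow>
      (\<forall>r i. \<bar>imem s r i\<bar> \<le> B) \<longrightarrow>
      static_input m d n N a x T s \<longrightarrow>
      (\<exists>t s'. exec B P s t s' \<and> static_output m n N a w T s' \<and> real t \<le> C * f n N))"

end

(*
  Fixing one coordinate of a k-dimensional instance to c gives a (k-1)-dimensional instance of the
  same rank: the vector of the fixed coordinate is multiplied into another factor. It computes the
  minimum over all directions l except the fixed one, so the instances with the last coordinate fixed
  and those with the first coordinate fixed (2n in all) together cover every l, as k >= 2. Preparing an
  instance and reading its result costs O(N n^(k-2)), because the last coordinate of a tuple in the band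
  is determined up to N choices by the others. Writing n vectors per call would be too slow for k = 2;
  there the one-dimensional instance is shifted into {1..2N}, and whatever the shift takes out of {1..n}
  gets weight 0 and table value infinity.
*)
theory Submission
  imports Defs
begin

section \<open>Programs: frames, renaming, loops and word sizes\<close>

text \<open>The given program is called 2n times on one machine. Adding 5 to all its array names
  keeps the input, the accumulated minima and the loop counters out of its reach; as a program must
  work for arbitrary initial words, nothing has to be cleared between two calls. Two budgets shape
  the rest. Words: if all loaded words are at most \<open>M\<close>, every intermediate result is at
  most \<open>M ^ K\<close> with \<open>K\<close> read off from the program text, so a word bound
  polynomial in n + N + |a| + 2 is enough. Time: up to constants the calls cost N powr (2 -
  \<epsilon>) * n ^ (k - 1) and the work around them N * n ^ (k - 1). The latter is linear in N,
  hence the exponent gained is the minimum of \<epsilon> and 1. For k = 2 the instances have side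
  length 2N instead of n, which leaves the bound for a call unchanged because the side length enters
  with exponent k - 2 = 0.\<close>

definition words :: "int \<Rightarrow> state \<Rightarrow> bool" where
  "words B s \<longleftrightarrow> (\<forall>r i. \<bar>imem s r i\<bar> \<le> B)"

lemma iok_ival_le: "iok B s e \<Longrightarrow> \<bar>ival s e\<bar> \<le> B"
  by (cases e) simp_all

text \<open>Every integer that is stored has passed the check \<open>iok\<close>. This is what lets
  a later call assume that its memory, though full of leftovers, consists of words.\<close>

lemma exec_words: "exec B c s t s' \<Longrightarrow> words B s \<Longrightarrow> words B s'"
  by (induction rule: exec.induct) (auto simp: words_def istore_def rstore_def iok_ival_le)

primrec mods :: "com \<Rightarrow> nat set" where
  "mods Skip = {}"
| "mods (IStore r e f) = {r}"
| "mods (RStore r e f) = {r}"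
| "mods (Seq c d) = mods c \<union> mods d"
| "mods (Cond b c d) = mods c \<union> mods d"
| "mods (While b c) = mods c"

text \<open>Array names are fixed in the program text, so the arrays a program may change form a
  syntactic set; integer and real arrays of the same name are not distinguished.\<close>

definition agree :: "nat set \<Rightarrow> state \<Rightarrow> state \<Rightarrow> bool" where
  "agree X s s' \<longleftrightarrow> (\<forall>r. r \<notin> X \<longrightarrow> imem s' r = imem s r \<and> rmem s' r = rmem s r)"

lemma agree_imem: "agree X s s' \<Longrightarrow> r \<notin> X \<Longrightarrow> imem s' r = imem s r"
  and agree_rmem: "agree X s s' \<Longrightarrow> r \<notin> X \<Longrightarrow> rmem s' r = rmem s r"
  by (auto simp: agree_def)

lemma agree_refl [simp]: "agree X s s"
  by (simp add: agree_def)

lemma agree_trans: "agree X s s1 \<Longrightarrow> agree Y s1 s2 \<Longrightarrow> X \<subseteq> Z \<Longrightarrow> Y \<subseteq> Z \<Longrightarrow> agree Z s s2"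
  unfolding agree_def by (metis subsetD)

lemma exec_agree: "exec B c s t s' \<Longrightarrow> agree (mods c) s s'"
  by (induction rule: exec.induct) (auto simp: agree_def istore_def rstore_def)

section \<open>Relocation of a program to higher array names\<close>

primrec iren :: "nat \<Rightarrow> iexp \<Rightarrow> iexp" where
  "iren k (IConst v) = IConst v"
| "iren k (ILoad r e) = ILoad (r + k) (iren k e)"
| "iren k (IAdd e f) = IAdd (iren k e) (iren k f)"
| "iren k (ISub e f) = ISub (iren k e) (iren k f)"
| "iren k (IMul e f) = IMul (iren k e) (iren k f)"
| "iren k (IDiv e f) = IDiv (iren k e) (iren k f)"
| "iren k (IMod e f) = IMod (iren k e) (iren k f)"

primrec rren :: "nat \<Rightarrow> rexp \<Rightarrow> rexp" where
  "rren k (ROfInt e) = ROfInt (iren k e)"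
| "rren k (RLoad r e) = RLoad (r + k) (iren k e)"
| "rren k (RAdd e f) = RAdd (rren k e) (rren k f)"
| "rren k (RSub e f) = RSub (rren k e) (rren k f)"
| "rren k (RMul e f) = RMul (rren k e) (rren k f)"
| "rren k (RDiv e f) = RDiv (rren k e) (rren k f)"

primrec bren :: "nat \<Rightarrow> bexp \<Rightarrow> bexp" where
  "bren k (ILess e f) = ILess (iren k e) (iren k f)"
| "bren k (RLess e f) = RLess (rren k e) (rren k f)"
| "bren k (BNot b) = BNot (bren k b)"
| "bren k (BAnd b c) = BAnd (bren k b) (bren k c)"

primrec cren :: "nat \<Rightarrow> com \<Rightarrow> com" where
  "cren k Skip = Skip"
| "cren k (IStore r e f) = IStore (r + k) (iren k e) (iren k f)"
| "cren k (RStore r e f) = RStore (r + k) (iren k e) (rren k f)"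
| "cren k (Seq c d) = Seq (cren k c) (cren k d)"
| "cren k (Cond b c d) = Cond (bren k b) (cren k c) (cren k d)"
| "cren k (While b c) = While (bren k b) (cren k c)"

text \<open>The part of memory that a relocated program sees, presented under the original
  names.\<close>

definition upper :: "nat \<Rightarrow> state \<Rightarrow> state" where
  "upper k s = \<lparr>imem = \<lambda>r. imem s (r + k), rmem = \<lambda>r. rmem s (r + k)\<rparr>"

lemma upper_sel [simp]:
  "imem (upper k s) r = imem s (r + k)" "rmem (upper k s) r = rmem s (r + k)"
  by (simp_all add: upper_def)

lemma upper_istore: "upper k (istore (r + k) i v s) = istore r i v (upper k s)"
  by (auto simp: upper_def istore_def fun_eq_iff)

lemma upper_rstore: "upper k (rstore (r + k) i v s) = rstore r i v (upper k s)"
  by (auto simp: upper_def rstore_def fun_eq_iff)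

lemma ival_iren [simp]: "ival s (iren k e) = ival (upper k s) e"
  by (induction e) simp_all
lemma iok_iren [simp]: "iok B s (iren k e) = iok B (upper k s) e"
  by (induction e) simp_all
lemma rval_rren [simp]: "rval s (rren k e) = rval (upper k s) e"
  by (induction e) simp_all
lemma rok_rren [simp]: "rok B s (rren k e) = rok B (upper k s) e"
  by (induction e) simp_all
lemma bval_bren [simp]: "bval s (bren k b) = bval (upper k s) b"
  by (induction b) simp_all
lemma bok_bren [simp]: "bok B s (bren k b) = bok B (upper k s) b"
  by (induction b) simp_all

text \<open>A step-by-step simulation: expressions of the relocated program have the same values and
  pass the same word checks in \<open>s\<close> as the original ones in \<open>upper k s\<close>, so
  even the step count is preserved.\<close>

lemma exec_cren:
  "exec B c u t u' \<Longrightarrow> u = upper k s \<Longrightarrow> \<exists>s'. exec B (cren k c) s t s' \<and> u' = upper k s'"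
proof (induction arbitrary: s rule: exec.induct)
  case (Skip u)
  then show ?case by (metis cren.simps(1) exec.Skip)
next
  case (IStore u e f r)
  then have "exec B (cren k (com.IStore r e f)) s 1 (istore (r + k) (ival s (iren k e)) (ival s (iren k f)) s)"
    unfolding cren.simps by (intro exec.IStore) simp_all
  then show ?case using IStore by (metis ival_iren upper_istore)
next
  case (RStore u e f r)
  then have "exec B (cren k (com.RStore r e f)) s 1 (rstore (r + k) (ival s (iren k e)) (rval s (rren k f)) s)"
    unfolding cren.simps by (intro exec.RStore) simp_all
  then show ?case using RStore by (metis ival_iren rval_rren upper_rstore)
next
  case (Seq c1 u t1 u1 c2 t2 u2)
  then show ?case by (metis cren.simps(4) exec.Seq)
next
  case (CondTrue u b c1 t u1 c2)
  then show ?case by (metis cren.simps(5) exec.CondTrue bok_bren bval_bren)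
next
  case (CondFalse u b c2 t u1 c1)
  then show ?case by (metis cren.simps(5) exec.CondFalse bok_bren bval_bren)
next
  case (WhileFalse u b c)
  then show ?case by (metis cren.simps(6) exec.WhileFalse bok_bren bval_bren)
next
  case (WhileTrue u b c t1 u1 t2 u2)
  then show ?case by (metis cren.simps(6) exec.WhileTrue bok_bren bval_bren)
qed

lemma mods_cren: "r \<in> mods (cren k c) \<Longrightarrow> k \<le> r"
  by (induction c) auto

section \<open>Time-bounded total correctness and counting loops\<close>

definition runs :: "int \<Rightarrow> com \<Rightarrow> state \<Rightarrow> real \<Rightarrow> (state \<Rightarrow> bool) \<Rightarrow> bool" where
  "runs B c s K Q \<longleftrightarrow> (\<exists>t s'. exec B c s t s' \<and> real t \<le> K \<and> Q s')"

lemma runs_mono: "runs B c s K Q \<Longrightarrow> K \<le> K' \<Longrightarrow> (\<And>s'. Q s' \<Longrightarrow> Q' s') \<Longrightarrow> runs B c s K' Q'"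
  unfolding runs_def by (meson order_trans)

lemma runs_frame:
  "runs B c s K Q \<Longrightarrow> words B s \<Longrightarrow> runs B c s K (\<lambda>s'. Q s' \<and> words B s' \<and> agree (mods c) s s')"
  unfolding runs_def by (meson exec_words exec_agree)

lemma runs_Skip: "Q s \<Longrightarrow> 1 \<le> K \<Longrightarrow> runs B Skip s K Q"
  unfolding runs_def using exec.Skip by (metis of_nat_1)

lemma runs_IStore:
  "iok B s e \<Longrightarrow> iok B s f \<Longrightarrow> Q (istore r (ival s e) (ival s f) s) \<Longrightarrow> 1 \<le> K \<Longrightarrow> runs B (IStore r e f) s K Q"
  unfolding runs_def using exec.IStore by (metis of_nat_1)

lemma runs_RStore:
  "iok B s e \<Longrightarrow> rok B s f \<Longrightarrow> Q (rstore r (ival s e) (rval s f) s) \<Longrightarrow> 1 \<le> K \<Longrightarrow> runs B (RStore r e f) s K Q"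
  unfolding runs_def using exec.RStore by (metis of_nat_1)

lemma runs_Seq:
  assumes "runs B c s K1 R" "\<And>s'. R s' \<Longrightarrow> runs B d s' K2 Q" "K1 + K2 \<le> K"
  shows "runs B (Seq c d) s K Q"
proof -
  obtain t1 s1 where 1: "exec B c s t1 s1" "real t1 \<le> K1" "R s1"
    using assms(1) unfolding runs_def by blast
  obtain t2 s2 where 2: "exec B d s1 t2 s2" "real t2 \<le> K2" "Q s2"
    using assms(2)[OF 1(3)] unfolding runs_def by blast
  have "real (t1 + t2) \<le> K" using 1 2 assms(3) by simp
  then show ?thesis using exec.Seq[OF 1(1) 2(1)] 2(3) unfolding runs_def by blast
qed

lemma runs_Cond:
  assumes "bok B s b" "bval s b \<Longrightarrow> runs B c s K Q" "\<not> bval s b \<Longrightarrow> runs B d s K Q" "K + 1 \<le> K'"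
  shows "runs B (Cond b c d) s K' Q"
proof (cases "bval s b")
  case True
  then obtain t s1 where "exec B c s t s1" "real t \<le> K" "Q s1"
    using assms(2) unfolding runs_def by blast
  moreover from this have "real (t + 1) \<le> K'" using assms(4) by simp
  ultimately show ?thesis using True assms(1) exec.CondTrue unfolding runs_def by metis
next
  case False
  then obtain t s1 where "exec B d s t s1" "real t \<le> K" "Q s1"
    using assms(3) unfolding runs_def by blast
  moreover from this have "real (t + 1) \<le> K'" using assms(4) by simp
  ultimately show ?thesis using False assms(1) exec.CondFalse unfolding runs_def by metis
qed

definition For :: "nat \<Rightarrow> iexp \<Rightarrow> com \<Rightarrow> com" where
  "For r E b = Seq (IStore r (IConst 0) (IConst 0))
    (While (ILess (ILoad r (IConst 0)) E)
      (Seq b (IStore r (IConst 0) (IAdd (ILoad r (IConst 0)) (IConst 1)))))"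

lemma mods_For [simp]: "mods (For r E b) = insert r (mods b)"
  by (auto simp: For_def)

text \<open>The bound expression is evaluated at every test, so it must keep its value while the
  body runs; the invariant must ignore the counter cell. The 2 pays for initialising the counter and
  for the failing test, and the 2 per round for the successful test and the increment.\<close>

lemma runs_For:
  assumes words: "words B s" and r: "r \<notin> mods b" and UB: "1 \<le> B" "int U \<le> B"
    and E: "\<And>s'. agree (insert r (mods b)) s s' \<Longrightarrow> ival s' E = int U \<and> iok B s' E"
    and I0: "I 0 s" and Ir: "\<And>u v s'. I u s' \<Longrightarrow> I u (istore r 0 v s')"
    and step: "\<And>u s'. u < U \<Longrightarrow> I u s' \<Longrightarrow> words B s' \<Longrightarrow> imem s' r 0 = int u \<Longrightarrow>
      agree (insert r (mods b)) s s' \<Longrightarrow> runs B b s' K (I (Suc u))"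
    and K': "2 + real U * (K + 2) \<le> K'"
  shows "runs B (For r E b) s K' (\<lambda>s'. I U s' \<and> words B s' \<and> agree (insert r (mods b)) s s')"
proof -
  let ?A = "agree (insert r (mods b)) s"
  let ?R = "\<lambda>s'. I U s' \<and> words B s' \<and> ?A s'"
  let ?i = "IStore r (IConst 0) (IAdd (ILoad r (IConst 0)) (IConst 1))"
  let ?W = "While (ILess (ILoad r (IConst 0)) E) (Seq b ?i)"
  have st: "?A (istore r i v s')" if "?A s'" for i v s'
    using that by (auto simp: agree_def istore_def)
  have ld: "\<bar>imem s' q i\<bar> \<le> B" if "words B s'" for s' q i
    using that by (simp add: words_def)
  \<comment> \<open>Induction on the number \<open>U - u\<close> of remaining rounds.\<close>
  have loop: "runs B ?W s' (1 + real (U - u) * (K + 2)) ?R"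
    if "u \<le> U" "I u s'" "words B s'" "imem s' r 0 = int u" "?A s'" for u s'
    using that
  proof (induction "U - u" arbitrary: u s')
    case 0
    then have "U = u" by simp
    then have "exec B ?W s' 1 s'"
      using 0 E[OF 0(6)] UB ld[OF 0(4)] by (intro exec.WhileFalse) auto
    then show ?case using 0 \<open>U = u\<close> unfolding runs_def by (metis of_nat_1 add.right_neutral diff_self_eq_0 mult_zero_left of_nat_0 order_refl)
  next
    case (Suc j)
    then have u: "u < U" by simp
    have "runs B b s' K (\<lambda>s1. I (Suc u) s1 \<and> words B s1 \<and> agree (mods b) s' s1)"
      using runs_frame[OF step[OF u] Suc.prems(3)] Suc.prems by blast
    then obtain t1 s1 where 1: "exec B b s' t1 s1" "real t1 \<le> K" "I (Suc u) s1" "words B s1" "agree (mods b) s' s1"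
      unfolding runs_def by blast
    have c: "imem s1 r 0 = int u" using 1(5) r Suc.prems(4) by (simp add: agree_def)
    let ?s2 = "istore r 0 (int (Suc u)) s1"
    have A1: "?A s1" using agree_trans[OF Suc.prems(5) 1(5)] by blast
    have "exec B ?i s1 1 (istore r (ival s1 (IConst 0)) (ival s1 (IAdd (ILoad r (IConst 0)) (IConst 1))) s1)"
      by (rule exec.IStore) (use c u UB in auto)
    then have e2: "exec B ?i s1 1 ?s2" using c by (simp add: add.commute)
    have "runs B ?W ?s2 (1 + real (U - Suc u) * (K + 2)) ?R"
    proof (rule Suc.hyps(1))
      show "words B ?s2" using exec_words[OF e2 1(4)] .
      show "imem ?s2 r 0 = int (Suc u)" by (simp add: istore_def)
    qed (use Suc.hyps(2) u Ir[OF 1(3)] st[OF A1] in auto)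
    then obtain t3 s3 where 3: "exec B ?W ?s2 t3 s3" "real t3 \<le> 1 + real (U - Suc u) * (K + 2)" "?R s3"
      unfolding runs_def by blast
    have "exec B ?W s' ((t1 + 1) + t3 + 1) s3"
      by (rule exec.WhileTrue[OF _ _ exec.Seq[OF 1(1) e2] 3(1)])
        (use E[OF Suc.prems(5)] Suc.prems u UB ld[OF Suc.prems(3)] in auto)
    moreover have "real (U - u) = real (U - Suc u) + 1" using u by linarith
    then have "real ((t1 + 1) + t3 + 1) \<le> 1 + real (U - u) * (K + 2)"
      using 1(2) 3(2) by (simp add: algebra_simps)
    ultimately show ?case using 3(3) unfolding runs_def by blast
  qed
  have w0: "words B (istore r 0 0 s)" using words UB by (auto simp: words_def istore_def)
  show ?thesis unfolding For_def
  proof (rule runs_Seq[where R = "\<lambda>s'. s' = istore r 0 0 s" and ?K1.0 = 1])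
    show "runs B (IStore r (IConst 0) (IConst 0)) s 1 (\<lambda>s'. s' = istore r 0 0 s)"
      by (rule runs_IStore) (use UB in auto)
    fix s' assume "s' = istore r 0 0 s"
    then show "runs B ?W s' (1 + real (U - 0) * (K + 2)) ?R"
      using loop[of 0 s'] w0 Ir[OF I0] st[of s] by (simp add: istore_def)
  qed (use K' in simp)
qed

section \<open>Word bounds from the size of expressions\<close>

primrec isz :: "iexp \<Rightarrow> nat" where
  "isz (IConst v) = nat \<bar>v\<bar> + 1"
| "isz (ILoad r e) = isz e + 1"
| "isz (IAdd e f) = isz e + isz f + 1"
| "isz (ISub e f) = isz e + isz f + 1"
| "isz (IMul e f) = isz e + isz f + 1"
| "isz (IDiv e f) = isz e + isz f + 1"
| "isz (IMod e f) = isz e + isz f + 1"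

primrec rsz :: "rexp \<Rightarrow> nat" where
  "rsz (ROfInt e) = isz e"
| "rsz (RLoad r e) = isz e"
| "rsz (RAdd e f) = max (rsz e) (rsz f)"
| "rsz (RSub e f) = max (rsz e) (rsz f)"
| "rsz (RMul e f) = max (rsz e) (rsz f)"
| "rsz (RDiv e f) = max (rsz e) (rsz f)"

primrec bsz :: "bexp \<Rightarrow> nat" where
  "bsz (ILess e f) = max (isz e) (isz f)"
| "bsz (RLess e f) = max (rsz e) (rsz f)"
| "bsz (BNot b) = bsz b"
| "bsz (BAnd b c) = max (bsz b) (bsz c)"

primrec csz :: "com \<Rightarrow> nat" where
  "csz Skip = 0"
| "csz (IStore r e f) = max (isz e) (isz f)"
| "csz (RStore r e f) = max (isz e) (rsz f)"
| "csz (Seq c d) = max (csz c) (csz d)"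
| "csz (Cond b c d) = max (bsz b) (max (csz c) (csz d))"
| "csz (While b c) = max (bsz b) (csz c)"

text \<open>Only loaded words are bounded here, by a value \<open>M\<close> that may be far below
  the word bound; arithmetic on them is accounted for by the size of the expression.\<close>

primrec ibd :: "int \<Rightarrow> state \<Rightarrow> iexp \<Rightarrow> bool" where
  "ibd M s (IConst v) \<longleftrightarrow> True"
| "ibd M s (ILoad r e) \<longleftrightarrow> ibd M s e \<and> \<bar>imem s r (ival s e)\<bar> \<le> M"
| "ibd M s (IAdd e f) \<longleftrightarrow> ibd M s e \<and> ibd M s f"
| "ibd M s (ISub e f) \<longleftrightarrow> ibd M s e \<and> ibd M s f"
| "ibd M s (IMul e f) \<longleftrightarrow> ibd M s e \<and> ibd M s f"
| "ibd M s (IDiv e f) \<longleftrightarrow> ibd M s e \<and> ibd M s f"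
| "ibd M s (IMod e f) \<longleftrightarrow> ibd M s e \<and> ibd M s f"

primrec rbd :: "int \<Rightarrow> state \<Rightarrow> rexp \<Rightarrow> bool" where
  "rbd M s (ROfInt e) \<longleftrightarrow> ibd M s e"
| "rbd M s (RLoad r e) \<longleftrightarrow> ibd M s e"
| "rbd M s (RAdd e f) \<longleftrightarrow> rbd M s e \<and> rbd M s f"
| "rbd M s (RSub e f) \<longleftrightarrow> rbd M s e \<and> rbd M s f"
| "rbd M s (RMul e f) \<longleftrightarrow> rbd M s e \<and> rbd M s f"
| "rbd M s (RDiv e f) \<longleftrightarrow> rbd M s e \<and> rbd M s f"

primrec bbd :: "int \<Rightarrow> state \<Rightarrow> bexp \<Rightarrow> bool" where
  "bbd M s (ILess e f) \<longleftrightarrow> ibd M s e \<and> ibd M s f"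
| "bbd M s (RLess e f) \<longleftrightarrow> rbd M s e \<and> rbd M s f"
| "bbd M s (BNot b) \<longleftrightarrow> bbd M s b"
| "bbd M s (BAnd b c) \<longleftrightarrow> bbd M s b \<and> bbd M s c"

text \<open>For negative x and positive y, rounding down keeps the quotient between x and -1. A
  negative divisor is treated by negating both arguments, and division by 0 yields 0.\<close>

lemma abs_div_le: "\<bar>a div b\<bar> \<le> \<bar>a\<bar>" for a b :: int
proof -
  have *: "\<bar>x div y\<bar> \<le> \<bar>x\<bar>" if "y > 0" for x y :: int
  proof (cases "x \<ge> 0")
    case True
    have "x div y \<le> x" using div_le_dividend[of "nat x" "nat y"] True that
      by (metis int_nat_eq nat_div_distrib' nat_int_comparison(3) not_less order_le_less pos_imp_zdiv_nonneg_iff zdiv_int)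
    then show ?thesis using True that by (simp add: pos_imp_zdiv_nonneg_iff)
  next
    case False
    have "x div y < 0" using False that by (simp add: pos_imp_zdiv_neg_iff)
    moreover have "x \<le> x div y"
    proof -
      have "x * y \<le> x" using False that by (metis le_cases mult.right_neutral mult_left_mono_neg not_le zle_add1_eq_le zless_imp_add1_zle add_0)
      then have "x * y div y \<le> x div y" using that by (rule zdiv_mono1)
      then show ?thesis using that by simp
    qed
    ultimately show ?thesis by simp
  qed
  consider "b > 0" | "b = 0" | "b < 0" by linarith
  then show ?thesis
  proof cases
    case 3
    then show ?thesis using *[of "- b" "- a"] by simp
  qed (use * in auto)
qed

lemma abs_mod_le: "\<bar>a mod b\<bar> \<le> \<bar>a\<bar> + \<bar>b\<bar>" for a b :: int
proof -
  consider "b > 0" | "b = 0" | "b < 0" by linarith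
  then show ?thesis
  proof cases
    case 1
    then show ?thesis using pos_mod_bound[of b a] pos_mod_sign[of b a] by linarith
  next
    case 3
    then show ?thesis using neg_mod_bound[of b a] neg_mod_sign[of b a] by linarith
  qed simp
qed

lemma pow_add_le: "M ^ i + M ^ j \<le> M ^ (i + j + 1)" if "2 \<le> M" for M :: int
proof -
  have 1: "1 \<le> M ^ i" "1 \<le> M ^ j" using that by (simp_all add: one_le_power)
  \<comment> \<open>For x, y at least 1 this product gives x + y \<le> x * y + 1 \<le> 2 * x * y,
    and the factor 2 is absorbed by one more power of \<open>M\<close>.\<close>
  then have "0 \<le> (M ^ i - 1) * (M ^ j - 1)" by simp
  moreover have "1 \<le> M ^ i * M ^ j" using mult_mono[OF 1] 1 by simp
  ultimately have "M ^ i + M ^ j \<le> 2 * (M ^ i * M ^ j)" by (simp add: algebra_simps)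
  also have "\<dots> \<le> M * (M ^ i * M ^ j)" using that by (intro mult_right_mono) auto
  finally show ?thesis by (simp add: power_add)
qed

text \<open>The function \<open>isz\<close> is an exponent rather than a node count: a constant v
  counts |v| + 1, so that a power of 2 dominates it, and each operation adds 1, which pays for the
  sum of two powers.\<close>

lemma ival_le_pow:
  assumes M: "2 \<le> M"
  shows "ibd M s e \<Longrightarrow> \<bar>ival s e\<bar> \<le> M ^ isz e"
proof (induction e)
  case (IConst v)
  have "\<bar>v\<bar> \<le> 2 ^ (nat \<bar>v\<bar> + 1)"
    using less_exp[of "nat \<bar>v\<bar> + 1"] by (metis abs_ge_zero int_nat_eq less_add_one nat_less_iff of_nat_less_numeral_power_cancel_iff order_less_imp_le order_less_trans zless_nat_eq_int_zless)
  also have "\<dots> \<le> M ^ (nat \<bar>v\<bar> + 1)" using M by (rule power_mono) simp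
  finally show ?case by simp
next
  case (ILoad r e)
  have "M ^ 1 \<le> M ^ (isz e + 1)" using M by (intro power_increasing) auto
  then show ?case using ILoad by simp
next
  case (IAdd e f)
  then show ?case using pow_add_le[OF M, of "isz e" "isz f"] by simp
next
  case (ISub e f)
  then show ?case using pow_add_le[OF M, of "isz e" "isz f"] by simp
next
  case (IMul e f)
  have "\<bar>ival s e * ival s f\<bar> \<le> M ^ isz e * M ^ isz f"
    unfolding abs_mult using IMul M by (intro mult_mono) auto
  also have "\<dots> \<le> M ^ (isz e + isz f + 1)" unfolding power_add[symmetric] using M by (intro power_increasing) auto
  finally show ?case by simp
next
  case (IDiv e f)
  have "M ^ isz e \<le> M ^ (isz e + isz f + 1)" using M by (intro power_increasing) auto
  then show ?case using IDiv abs_div_le[of "ival s e" "ival s f"] by simp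
next
  case (IMod e f)
  then show ?case using pow_add_le[OF M, of "isz e" "isz f"] abs_mod_le[of "ival s e" "ival s f"] by simp
qed

text \<open>All subexpressions have smaller size, hence the same power of \<open>M\<close> bounds
  each intermediate result.\<close>

lemma iok_if_ibd:
  assumes M: "2 \<le> M" "M ^ K \<le> B"
  shows "ibd M s e \<Longrightarrow> isz e \<le> K \<Longrightarrow> iok B s e"
proof (induction e)
  have le: "\<bar>ival s e\<bar> \<le> B" if "ibd M s e" "isz e \<le> K" for e
  proof -
    have "M ^ isz e \<le> M ^ K" using M that by (intro power_increasing) auto
    then show ?thesis using ival_le_pow[OF M(1) that(1)] M(2) by linarith
  qed
  { case (IConst v) then show ?case using le[of "iexp.IConst v"] by simp }
  { case (ILoad r e) then show ?case using le[of "iexp.ILoad r e"] by simp }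
  { case (IAdd e f) then show ?case using le[of "iexp.IAdd e f"] by simp }
  { case (ISub e f) then show ?case using le[of "iexp.ISub e f"] by simp }
  { case (IMul e f) then show ?case using le[of "iexp.IMul e f"] by simp }
  { case (IDiv e f) then show ?case using le[of "iexp.IDiv e f"] by simp }
  { case (IMod e f) then show ?case using le[of "iexp.IMod e f"] by simp }
qed

lemma rok_if_rbd: "2 \<le> M \<Longrightarrow> M ^ K \<le> B \<Longrightarrow> rbd M s e \<Longrightarrow> rsz e \<le> K \<Longrightarrow> rok B s e"
  by (induction e) (auto intro: iok_if_ibd)

lemma bok_if_bbd: "2 \<le> M \<Longrightarrow> M ^ K \<le> B \<Longrightarrow> bbd M s b \<Longrightarrow> bsz b \<le> K \<Longrightarrow> bok B s b"
  by (induction b) (auto intro: iok_if_ibd rok_if_rbd)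

section \<open>Fixing one coordinate\<close>

definition ins :: "nat \<Rightarrow> 'a \<Rightarrow> 'a list \<Rightarrow> 'a list" where
  "ins p c js = take p js @ c # drop p js"

text \<open>The position in the long tuple of what stood at position \<open>t\<close> before
  something was inserted at \<open>p\<close>.\<close>

definition skip :: "nat \<Rightarrow> nat \<Rightarrow> nat" where
  "skip p t = (if t < p then t else t + 1)"

lemma length_ins [simp]: "length (ins p c js) = length js + 1"
  by (simp add: ins_def)

lemma set_ins [simp]: "set (ins p c js) = insert c (set js)"
proof -
  have "set (ins p c js) = insert c (set (take p js @ drop p js))" by (simp only: ins_def set_append) auto
  then show ?thesis by simp
qed

lemma sum_list_ins [simp]: "sum_list (ins p c js) = c + sum_list js" for c :: nat
proof -
  have "sum_list (ins p c js) = c + sum_list (take p js @ drop p js)" by (simp only: ins_def sum_list_append) simp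
  then show ?thesis by simp
qed

lemma map_ins: "map f (ins p c js) = ins p (f c) (map f js)"
  by (simp add: ins_def take_map drop_map)

lemma ins_nth: "p \<le> length js \<Longrightarrow> ins p c js ! p = c"
  by (simp add: ins_def nth_append)

lemma ins_nth_skip: "p \<le> length js \<Longrightarrow> t < length js \<Longrightarrow> ins p c js ! skip p t = js ! t"
  by (auto simp: ins_def skip_def nth_append min_def Suc_diff_le)

lemma ins_append: "p \<le> length js \<Longrightarrow> ins p c (js @ ks) = ins p c js @ ks"
  by (simp add: ins_def)

lemma ins_update:
  assumes "p \<le> length js"
  shows "(ins p c js)[skip p l := i] = ins p c (js[l := i])"
proof (cases "l < p")
  case True
  then show ?thesis using assms by (simp add: ins_def skip_def list_update_append1 take_update_swap)
next
  case False
  then have "l + 1 - p = Suc (l - p)" by simp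
  then show ?thesis using False assms
    by (simp add: ins_def skip_def list_update_append drop_update_swap)
qed

lemma ins_remove: "p < length js \<Longrightarrow> js = ins p (js ! p) (take p js @ drop (Suc p) js)"
  by (simp add: ins_def id_take_nth_drop[symmetric])

lemma inj_on_skip: "inj_on (skip p) A"
  by (auto simp: inj_on_def skip_def split: if_splits)

lemma skip_split: "p \<le> m \<Longrightarrow> {..<m + 1} = insert p (skip p ` {..<m})"
proof (intro equalityI subsetI)
  fix t assume "p \<le> m" "t \<in> {..<m + 1}"
  then have "t = p \<or> t = skip p t \<and> t < m \<or> t = skip p (t - 1) \<and> t - 1 < m" by (auto simp: skip_def)
  then show "t \<in> insert p (skip p ` {..<m})" by blast
qed (auto simp: skip_def)

lemma skip_neq: "skip p t \<noteq> p"
  by (auto simp: skip_def)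

section \<open>Minima separated by direction\<close>

definition cand :: "nat \<Rightarrow> nat \<Rightarrow> int \<Rightarrow> (nat \<Rightarrow> nat list \<Rightarrow> int) \<Rightarrow> (nat list \<Rightarrow> ereal) \<Rightarrow> nat list \<Rightarrow> nat \<Rightarrow> ereal" where
  "cand n N a w T js l =
    (INF i\<in>{i \<in> {1..n}. a \<le> int (sum_list (js[l := i])) \<and> int (sum_list (js[l := i])) < a + int N}.
      T (js[l := i]) + ereal (real_of_int (w l (js @ [i]))))"

text \<open>Changing coordinate l to i makes the coordinate sum J + i, so the window for i says that
  the changed tuple lies in the input band. In this form a fixed coordinate merely moves the
  bounds.\<close>

lemma static_value_cand:
  assumes "length js = m"
  shows "static_value m n N a w T js = (INF l\<in>{..<m}. cand n N a w T js l)"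
  unfolding static_value_def Let_def cand_def
proof (intro INF_cong refl)
  fix l assume l: "l \<in> {..<m}"
  have "int (sum_list (js[l := i])) = (\<Sum>t\<in>{..<m} - {l}. int (js ! t)) + int i" for i
  proof -
    have "int (sum_list (js[l := i])) = (\<Sum>t<m. int (js[l := i] ! t))"
      using assms by (simp add: sum_list_sum_nth atLeast0LessThan)
    also have "\<dots> = int i + (\<Sum>t\<in>{..<m} - {l}. int (js[l := i] ! t))"
      using l assms by (subst sum.remove[of _ l]) auto
    also have "(\<Sum>t\<in>{..<m} - {l}. int (js[l := i] ! t)) = (\<Sum>t\<in>{..<m} - {l}. int (js ! t))"
      by (intro sum.cong) auto
    finally show ?thesis by simp
  qed
  then show "{i \<in> {1..n}. a - (\<Sum>t\<in>{..<m} - {l}. int (js ! t)) \<le> int i \<and>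
       int i < a + int N - (\<Sum>t\<in>{..<m} - {l}. int (js ! t))} =
     {i \<in> {1..n}. a \<le> int (sum_list (js[l := i])) \<and> int (sum_list (js[l := i])) < a + int N}"
    by auto
qed

text \<open>
  The instance that arises when coordinate \<open>p\<close> is fixed to \<open>c\<close> and the others are shifted down by \<open>o'\<close>.
  Entries that the shift moves out of the original cube get weight 0 and table value \<open>\<infinity>\<close>.
\<close>

definition inr :: "nat \<Rightarrow> int \<Rightarrow> nat \<Rightarrow> bool" where
  "inr n o' i \<longleftrightarrow> 1 \<le> int i + o' \<and> int i + o' \<le> int n"

definition un :: "int \<Rightarrow> nat \<Rightarrow> nat" where
  "un o' i = nat (int i + o')"

definition fixT :: "nat \<Rightarrow> nat \<Rightarrow> nat \<Rightarrow> int \<Rightarrow> (nat list \<Rightarrow> ereal) \<Rightarrow> nat list \<Rightarrow> ereal" where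
  "fixT p c n o' T js = (if \<forall>i\<in>set js. inr n o' i then T (ins p c (map (un o') js)) else \<infinity>)"

definition fixw ::
    "nat \<Rightarrow> nat \<Rightarrow> nat \<Rightarrow> int \<Rightarrow> (nat \<Rightarrow> nat list \<Rightarrow> int) \<Rightarrow> nat \<Rightarrow> nat list \<Rightarrow> int" where
  "fixw p c n o' w l js = (if \<forall>i\<in>set js. inr n o' i then w (skip p l) (ins p c (map (un o') js)) else 0)"

text \<open>The factor of the fixed coordinate is attached to position 0, which always exists. Out
  of range the whole vector is 0, so a single bad index makes the inner product 0; the last index of
  a weight is shifted like the coordinates.\<close>

definition fixx ::
    "nat \<Rightarrow> nat \<Rightarrow> nat \<Rightarrow> int \<Rightarrow> (nat \<Rightarrow> nat \<Rightarrow> nat \<Rightarrow> nat \<Rightarrow> real) \<Rightarrow> nat \<Rightarrow> nat \<Rightarrow> nat \<Rightarrow> nat \<Rightarrow> real" where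
  "fixx p c n o' x l t i q =
    (if inr n o' i
     then x (skip p l) (skip p t) (un o' i) q * (if t = 0 then x (skip p l) p c q else 1) else 0)"

lemma int_un: "inr n o' i \<Longrightarrow> int (un o' i) = int i + o'"
  by (simp add: inr_def un_def)

lemma sum_un:
  "\<forall>i\<in>set js. inr n o' i \<Longrightarrow> int (sum_list (map (un o') js)) = int (sum_list js) + int (length js) * o'"
  by (induction js) (auto simp: int_un algebra_simps)

lemma un_cube: "js \<in> cube n' m \<Longrightarrow> \<forall>i\<in>set js. inr n o' i \<Longrightarrow> map (un o') js \<in> cube n m"
  by (fastforce simp: cube_def inr_def un_def)

lemma un_band:
  assumes "js \<in> band n' m \<alpha> \<beta>" "\<forall>i\<in>set js. inr n o' i"
  shows "map (un o') js \<in> band n m (\<alpha> + int m * o') (\<beta> + int m * o')"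
  using assms un_cube[of js n' m n o'] sum_un[of js n o'] by (auto simp: band_def cube_def)

lemma ins_cube: "js \<in> cube n m \<Longrightarrow> c \<in> {1..n} \<Longrightarrow> ins p c js \<in> cube n (m + 1)"
  by (auto simp: cube_def)

lemma ins_band:
  "js \<in> band n m \<alpha> \<beta> \<Longrightarrow> c \<in> {1..n} \<Longrightarrow> ins p c js \<in> band n (m + 1) (\<alpha> + int c) (\<beta> + int c)"
  unfolding band_def using ins_cube[of js n m c p] by auto

lemma prod_list_map_upt: "(\<Prod>x\<leftarrow>map f [0..<q]. g x) = (\<Prod>t<q. g (f t))" for g :: "'b \<Rightarrow> real"
  by (induction q) (auto simp: mult.commute)

text \<open>In each of the \<open>d\<close> summands the factor at position \<open>p\<close> no
  longer depends on the tuple, so it can be merged into another factor without raising the rank. The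
  condition \<open>p \<le> m\<close> places \<open>p\<close> among the coordinates, not at the extra
  index of the weight.\<close>

lemma fix_rank:
  assumes w: "rank_witness n (m + 2) d (\<lambda>js. real_of_int (w (skip p l) js)) (x (skip p l))"
    and p: "p \<le> m" and c: "c \<in> {1..n}"
  shows "rank_witness n' (m + 1) d (\<lambda>js. real_of_int (fixw p c n o' w l js)) (fixx p c n o' x l)"
  unfolding rank_witness_def
proof
  fix js assume js: "js \<in> cube n' (m + 1)"
  then have len: "length js = m + 1" by (simp add: cube_def)
  show "real_of_int (fixw p c n o' w l js) = gen_inner d (map (\<lambda>t. fixx p c n o' x l t (js ! t)) [0..<m + 1])"
  proof (cases "\<forall>i\<in>set js. inr n o' i")
    case True
    let ?ks = "ins p c (map (un o') js)"
    have ks: "?ks \<in> cube n (m + 2)" using ins_cube[OF un_cube[OF js True] c, of p] by simp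
    have "(\<Prod>t<m + 2. x (skip p l) t (?ks ! t) q) = (\<Prod>t<m + 1. fixx p c n o' x l t (js ! t) q)" for q
    proof -
      have "(\<Prod>t<m + 2. x (skip p l) t (?ks ! t) q) =
          (\<Prod>t\<in>insert p (skip p ` {..<m + 1}). x (skip p l) t (?ks ! t) q)"
        using skip_split[of p "m + 1"] p by simp
      also have "\<dots> = x (skip p l) p c q * (\<Prod>t<m + 1. x (skip p l) (skip p t) (?ks ! skip p t) q)"
        using p len skip_neq[of p, symmetric]
        by (subst prod.insert) (auto simp: prod.reindex inj_on_skip ins_nth image_iff)
      also have "(\<Prod>t<m + 1. x (skip p l) (skip p t) (?ks ! skip p t) q) =
          (\<Prod>t<m + 1. x (skip p l) (skip p t) (un o' (js ! t)) q)"
        using p len by (intro prod.cong refl) (subst ins_nth_skip; simp)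
      \<comment> \<open>The constant factor is written as a product concentrated at position 0, so
        that the two products can be combined factor by factor.\<close>
      also have "x (skip p l) p c q = (\<Prod>t<m + 1. if t = 0 then x (skip p l) p c q else 1)"
        by (simp add: prod.delta)
      also have "\<dots> * (\<Prod>t<m + 1. x (skip p l) (skip p t) (un o' (js ! t)) q) =
          (\<Prod>t<m + 1. fixx p c n o' x l t (js ! t) q)"
        unfolding prod.distrib[symmetric] using True len
        by (intro prod.cong refl) (auto simp: fixx_def)
      finally show ?thesis .
    qed
    then show ?thesis using w ks True
      unfolding rank_witness_def gen_inner_def prod_list_map_upt fixw_def by simp
  next
    case False
    then obtain t where "t < m + 1" "\<not> inr n o' (js ! t)" using len by (metis in_set_conv_nth)
    then have "(\<Prod>t<m + 1. fixx p c n o' x l t (js ! t) q) = 0" for q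
      by (intro prod_zero finite_lessThan bexI[of _ t]) (simp_all add: fixx_def)
    then have "gen_inner d (map (\<lambda>t. fixx p c n o' x l t (js ! t)) [0..<m + 1]) = 0"
      unfolding gen_inner_def prod_list_map_upt by (simp only: sum.neutral_const)
    then show ?thesis using False unfolding fixw_def by (simp only: if_False of_int_0)
  qed
qed

text \<open>Inserting \<open>c\<close> and undoing the shift raise the coordinate sum by c + m * o',
  which is subtracted from the start of the band. Since the table in an instance is arbitrary on its
  band, the restricted table qualifies without satisfying any recurrence.\<close>

lemma fix_instance:
  assumes I: "static_instance (m + 1) d n N a w x T" and p: "p \<le> m" and c: "c \<in> {1..n}" and n': "1 \<le> n'"
  shows "static_instance m d n' N (a - int c - int m * o') (fixw p c n o' w) (fixx p c n o' x) (fixT p c n o' T)"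
  unfolding static_instance_def
proof (intro conjI allI impI ballI)
  fix l assume "l < m"
  then have "skip p l < m + 1" by (simp add: skip_def)
  then show "rank_witness n' (m + 1) d (\<lambda>js. real_of_int (fixw p c n o' w l js)) (fixx p c n o' x l)"
    using I p c by (intro fix_rank) (auto simp: static_instance_def)
next
  fix js assume js: "js \<in> band n' m (a - int c - int m * o') (a - int c - int m * o' + int N)"
  show "fixT p c n o' T js = \<infinity> \<or> (\<exists>z::int. fixT p c n o' T js = ereal (real_of_int z))"
  proof (cases "\<forall>i\<in>set js. inr n o' i")
    case True
    have "ins p c (map (un o') js) \<in> band n (m + 1) a (a + int N)"
      using ins_band[OF un_band[OF js True] c, of p] by (simp add: algebra_simps)
    then show ?thesis using I True by (simp add: static_instance_def fixT_def)
  next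
    case False
    then show ?thesis unfolding fixT_def by (simp only: if_False simp_thms)
  qed
qed (use I n' in \<open>auto simp: static_instance_def\<close>)

text \<open>By \<open>cov\<close> every coordinate of a tuple in the relevant band stays in the cube
  after the shift, so no candidate is lost; the candidates that the small cube has in excess carry
  the table value infinity and do not affect the minimum.\<close>

lemma fix_cand:
  assumes cov: "\<And>ks i. ks \<in> band n m (a - int c) (a - int c + 2 * int N) \<Longrightarrow> i \<in> set ks \<Longrightarrow>
      1 \<le> int i - o' \<and> int i - o' \<le> int n'"
    and p: "p \<le> m" and js: "js \<in> cube n' m" and r: "\<forall>i\<in>set js. inr n o' i" and l: "l < m"
  shows "cand n' N (a - int c - int m * o') (fixw p c n o' w) (fixT p c n o' T) js l =
    cand n N a w T (ins p c (map (un o') js)) (skip p l)"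
proof -
  let ?ks = "map (un o') js"
  let ?a = "a - int c - int m * o'"
  have len: "length js = m" using js by (simp add: cube_def)
  have upd: "?ks[l := un o' i] = map (un o') (js[l := i])" for i by (simp add: map_update)
  have r': "\<forall>i'\<in>set (js[l := i]). inr n o' i'" if "inr n o' i" for i
    using r that set_update_subset_insert[of js l i] by auto
  have sum: "int (sum_list (js[l := i])) = int (sum_list (?ks[l := un o' i])) - int m * o'" if "inr n o' i" for i
    unfolding upd sum_un[OF r'[OF that]] using len by simp
  have T: "fixT p c n o' T (js[l := i]) = T ((ins p c ?ks)[skip p l := un o' i])" if "inr n o' i" for i
    using r'[OF that] len p by (simp add: fixT_def ins_update upd)
  have w: "fixw p c n o' w l (js @ [i]) = w (skip p l) (ins p c ?ks @ [un o' i])" if "inr n o' i" for i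
    using r that len p by (simp add: fixw_def ins_append)
  have i1: "inr n o' i" if "fixT p c n o' T (js[l := i]) \<noteq> \<infinity>" for i
    using that l len set_update_memI[of l js i] unfolding fixT_def by (metis)
  show ?thesis unfolding cand_def
  proof (intro antisym INF_greatest)
    fix i assume "i \<in> {i \<in> {1..n}. a \<le> int (sum_list ((ins p c ?ks)[skip p l := i])) \<and>
      int (sum_list ((ins p c ?ks)[skip p l := i])) < a + int N}"
    then have i: "i \<in> {1..n}" "a - int c \<le> int (sum_list (?ks[l := i]))" "int (sum_list (?ks[l := i])) < a - int c + int N"
      using p len by (auto simp: ins_update)
    have "?ks \<in> cube n m" using un_cube[OF js r] .
    then have "?ks[l := i] \<in> cube n m"
      using i(1) set_update_subset_insert[of ?ks l i] unfolding cube_def mem_Collect_eq length_list_update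
      by (metis insert_subset subset_trans)
    \<comment> \<open>The changed tuple lies in the lower half of the band covered by
      \<open>cov\<close>, and \<open>i\<close> is one of its entries.\<close>
    then have "?ks[l := i] \<in> band n m (a - int c) (a - int c + 2 * int N)" using i by (simp add: band_def)
    then have b: "1 \<le> int i - o'" "int i - o' \<le> int n'"
      using cov[of "?ks[l := i]" i] l len set_update_memI[of l ?ks i] by auto
    define i' where "i' = nat (int i - o')"
    have i': "inr n o' i'" "un o' i' = i" "i' \<in> {1..n'}" using b i(1) by (auto simp: i'_def inr_def un_def)
    show "(INF i\<in>{i \<in> {1..n'}. ?a \<le> int (sum_list (js[l := i])) \<and> int (sum_list (js[l := i])) < ?a + int N}.
        fixT p c n o' T (js[l := i]) + ereal (real_of_int (fixw p c n o' w l (js @ [i]))))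
      \<le> T ((ins p c ?ks)[skip p l := i]) + ereal (real_of_int (w (skip p l) (ins p c ?ks @ [i])))"
      by (rule INF_lower2[of i']) (use i i' sum[OF i'(1)] T[OF i'(1)] w[OF i'(1)] in auto)
  next
    fix i assume i: "i \<in> {i \<in> {1..n'}. ?a \<le> int (sum_list (js[l := i])) \<and> int (sum_list (js[l := i])) < ?a + int N}"
    show "(INF i\<in>{i \<in> {1..n}. a \<le> int (sum_list ((ins p c ?ks)[skip p l := i])) \<and>
        int (sum_list ((ins p c ?ks)[skip p l := i])) < a + int N}.
        T ((ins p c ?ks)[skip p l := i]) + ereal (real_of_int (w (skip p l) (ins p c ?ks @ [i]))))
      \<le> fixT p c n o' T (js[l := i]) + ereal (real_of_int (fixw p c n o' w l (js @ [i])))"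
    proof (cases "inr n o' i")
      case True
      have "un o' i \<in> {1..n}" using True by (auto simp: inr_def un_def)
      then show ?thesis
        by (intro INF_lower2[of "un o' i"]) (use i sum[OF True] T[OF True] w[OF True] p len in \<open>auto simp: ins_update\<close>)
    next
      \<comment> \<open>An index that is out of range occurs in the changed tuple and forces the
        table value infinity.\<close>
      case False
      then have "fixT p c n o' T (js[l := i]) = \<infinity>" using i1 by blast
      then show ?thesis by simp
    qed
  qed
qed

definition part_value :: "nat \<Rightarrow> nat \<Rightarrow> nat \<Rightarrow> nat \<Rightarrow> int \<Rightarrow> (nat \<Rightarrow> nat list \<Rightarrow> int) \<Rightarrow> (nat list \<Rightarrow> ereal) \<Rightarrow> nat list \<Rightarrow> ereal" where
  "part_value p m n N a w T js = (INF l\<in>skip p ` {..<m}. cand n N a w T js l)"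

lemma fix_static_value:
  assumes cov: "\<And>ks i. ks \<in> band n m (a - int c) (a - int c + 2 * int N) \<Longrightarrow> i \<in> set ks \<Longrightarrow>
      1 \<le> int i - o' \<and> int i - o' \<le> int n'"
    and p: "p \<le> m" and js: "js \<in> cube n' m" and r: "\<forall>i\<in>set js. inr n o' i"
  shows "static_value m n' N (a - int c - int m * o') (fixw p c n o' w) (fixT p c n o' T) js =
    part_value p m n N a w T (ins p c (map (un o') js))"
proof -
  have len: "length js = m" using js by (simp add: cube_def)
  show ?thesis unfolding static_value_cand[OF len] part_value_def image_image
    by (intro INF_cong refl) (use fix_cand[OF cov p js r] in auto)
qed

text \<open>Fixing the last coordinate leaves out only direction m, fixing the first only direction
  0; for \<open>1 \<le> m\<close> these differ.\<close>

lemma part_values: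
  assumes "1 \<le> m" "length js = m + 1"
  shows "static_value (m + 1) n N a w T js =
    min (part_value m m n N a w T js) (part_value 0 m n N a w T js)"
proof -
  have "{..<m + 1} = skip m ` {..<m} \<union> skip 0 ` {..<m}"
    using skip_split[of m m] skip_split[of 0 m] skip_neq assms(1)
    by (auto simp: skip_def image_iff)
  then show ?thesis unfolding static_value_cand[OF assms(2)] part_value_def
    by (simp add: INF_union inf_min)
qed

section \<open>Addresses and enumeration of tuples\<close>

definition taddr :: "int \<Rightarrow> int list \<Rightarrow> int" where
  "taddr n js = foldl (\<lambda>z j. z * (n + 1) + j) 0 js"

lemma tab_addr_taddr: "tab_addr n js = taddr (int n) (map int js)"
  unfolding tab_addr_def taddr_def by (induction js rule: rev_induct) (auto simp: algebra_simps)

lemma tab_addr_snoc: "tab_addr n (js @ [j]) = tab_addr n js * int (n + 1) + int j"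
  by (simp add: tab_addr_def algebra_simps)

text \<open>Addresses are numerals in base n + 1 whose digits are at most n. Thus writing one table
  entry cannot overwrite another one.\<close>

lemma tab_addr_inj:
  "tab_addr n js = tab_addr n ks \<Longrightarrow> js \<in> cube n m \<Longrightarrow> ks \<in> cube n m \<Longrightarrow> js = ks"
proof (induction js arbitrary: ks m rule: rev_induct)
  case Nil
  then show ?case by (simp add: cube_def)
next
  case (snoc j js)
  then obtain k ks' where ks: "ks = ks' @ [k]" by (cases ks rule: rev_cases) (auto simp: cube_def)
  have jk: "j < n + 1" "k < n + 1" using snoc.prems by (auto simp: ks cube_def)
  have eq: "tab_addr n js * int (n + 1) + int j = tab_addr n ks' * int (n + 1) + int k"
    using snoc.prems(1) unfolding ks tab_addr_snoc .
  have "(tab_addr n js * int (n + 1) + int j) div int (n + 1) = tab_addr n js"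
    "(tab_addr n ks' * int (n + 1) + int k) div int (n + 1) = tab_addr n ks'"
    using jk by (simp_all del: of_nat_Suc of_nat_add add: div_add1_eq[of "_ * _"])
  then have t: "tab_addr n js = tab_addr n ks'" using eq by metis
  then have "js = ks'" using snoc.prems by (intro snoc.IH[of _ "m - 1"]) (auto simp: ks cube_def)
  then show ?case using eq t by (simp add: ks)
qed

text \<open>
  One counter \<open>u\<close> runs through a band: its lowest base \<open>b\<close> digits are all coordinates but the last, and
  the remaining quotient is the excess of the coordinate sum over \<open>A\<close>. The last coordinate may be out of range.
\<close>

definition tup :: "int \<Rightarrow> nat \<Rightarrow> int \<Rightarrow> int \<Rightarrow> int list" where
  "tup b m A u = (let ds = map (\<lambda>t. u div b ^ t mod b + 1) [0..<m - 1] in ds @ [A + u div b ^ (m - 1) - sum_list ds])"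

lemma length_tup [simp]: "1 \<le> m \<Longrightarrow> length (tup b m A u) = m"
  by (simp add: tup_def Let_def)

lemma sum_list_tup: "sum_list (tup b m A u) = A + u div b ^ (m - 1)"
  by (simp add: tup_def Let_def)

lemma sum_list_map_int: "sum_list (map int js) = int (sum_list js)"
  by (induction js) auto

text \<open>All coordinates but the last are in range by construction, and the quotient by
  \<open>b ^ (m - 1)\<close> is below \<open>N\<close>; so the range check is all that separates a
  counter value from a tuple of the band.\<close>

lemma tup_sound:
  assumes m: "1 \<le> m" and b: "1 \<le> b" and u: "u < b ^ (m - 1) * N"
    and r: "\<forall>i\<in>set (tup (int b) m A (int u)). 1 \<le> i \<and> i \<le> int b"
  obtains js where "js \<in> band b m A (A + int N)" "tup (int b) m A (int u) = map int js"
proof -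
  let ?js = "map nat (tup (int b) m A (int u))"
  have eq: "tup (int b) m A (int u) = map int ?js"
    using r by (simp add: o_def) (rule map_idI[symmetric], force)
  have "int u div int b ^ (m - 1) = int (u div b ^ (m - 1))" by (simp add: zdiv_int)
  moreover have "u div b ^ (m - 1) < N" using u b by (simp add: less_mult_imp_div_less mult.commute)
  ultimately have s: "int (sum_list ?js) = A + int (u div b ^ (m - 1))" "u div b ^ (m - 1) < N"
    using sum_list_tup[of "int b" m A "int u"] sum_list_map_int[of ?js] eq by auto
  have "?js \<in> cube b m" using r m by (force simp: cube_def)
  then have "?js \<in> band b m A (A + int N)" using s by (simp add: band_def)
  then show ?thesis using that eq by blast
qed

lemma digits_exist:
  fixes b :: nat
  assumes "1 \<le> b" "set ds \<subseteq> {..<b}"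
  shows "\<exists>u<b ^ length ds. \<forall>t<length ds. u div b ^ t mod b = ds ! t"
  using assms(2)
proof (induction ds)
  case Nil
  then show ?case by simp
next
  case (Cons e ds)
  then obtain u where u: "u < b ^ length ds" "\<forall>t<length ds. u div b ^ t mod b = ds ! t" by auto
  have e: "e < b" using Cons.prems by simp
  \<comment> \<open>Horner step: the new lowest digit \<open>e\<close> is put below the digits of
    \<open>u\<close>.\<close>
  have "b * u + e < b * b ^ length ds"
  proof -
    have "b * (u + 1) \<le> b * b ^ length ds" using u(1) by (intro mult_le_mono2) simp
    then show ?thesis using e by (simp add: algebra_simps)
  qed
  moreover have "(b * u + e) div b ^ t mod b = (e # ds) ! t" if "t < length (e # ds)" for t
  proof (cases t)
    case (Suc t')
    have "(b * u + e) div b ^ t = (b * u + e) div b div b ^ t'" by (simp add: Suc div_mult2_eq)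
    then show ?thesis using e u(2) that Suc assms(1) by simp
  qed (use e in simp)
  ultimately show ?case by (intro exI[of _ "b * u + e"]) simp
qed

lemma tup_complete:
  assumes m: "1 \<le> m" and js: "js \<in> band b m A (A + int N)"
  obtains u where "u < b ^ (m - 1) * N" "tup (int b) m A (int u) = map int js"
proof -
  have len: "length js = m" and dig: "set js \<subseteq> {1..b}" using js by (auto simp: band_def cube_def)
  obtain z zs where js': "js = zs @ [z]" using len m by (cases js rule: rev_cases) auto
  have lz: "length zs = m - 1" using len js' by simp
  have b: "1 \<le> b" using dig len m js' by auto
  let ?ds = "map (\<lambda>i. i - 1) zs"
  have "set ?ds \<subseteq> {..<b}" using dig js' by force
  then obtain u where u: "u < b ^ (m - 1)" "\<And>t. t < m - 1 \<Longrightarrow> u div b ^ t mod b = zs ! t - 1"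
    using digits_exist[OF b, of ?ds] lz by auto
  \<comment> \<open>The excess of the coordinate sum over \<open>A\<close>, which becomes the
    leading part of the counter.\<close>
  define v where "v = nat (int (sum_list js) - A)"
  have v: "v < N" "int v = int (sum_list js) - A" using js by (auto simp: band_def v_def)
  let ?u = "u + b ^ (m - 1) * v"
  have "b ^ (m - 1) * (v + 1) \<le> b ^ (m - 1) * N" using v(1) by (intro mult_le_mono2) simp
  then have lt: "?u < b ^ (m - 1) * N" using u(1) by (simp add: algebra_simps)
  have dv: "?u div b ^ (m - 1) = v" using u(1) b by simp
  have dg: "?u div b ^ t mod b + 1 = zs ! t" if t: "t < m - 1" for t
  proof -
    \<comment> \<open>Below position m - 1, the leading part contributes a multiple of
      \<open>b\<close> after division by \<open>b ^ t\<close>, so it vanishes modulo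
      \<open>b\<close>.\<close>
    have e: "b ^ (m - 1) = b ^ t * (b * b ^ (m - 2 - t))"
    proof -
      have "m - 1 = t + (1 + (m - 2 - t))" using t by simp
      then show ?thesis by (metis power_add power_one_right)
    qed
    have "?u = u + b ^ t * (b * (b ^ (m - 2 - t) * v))" by (simp only: e mult.assoc)
    moreover have "(u + b ^ t * w) div b ^ t = u div b ^ t + w" for w using b by simp
    ultimately have "?u div b ^ t = u div b ^ t + b * (b ^ (m - 2 - t) * v)" by (simp only:)
    then have "?u div b ^ t mod b = zs ! t - 1" using u(2)[OF t] by simp
    moreover have "zs ! t \<in> set js" using t lz js' by simp
    then have "1 \<le> zs ! t" using dig by auto
    ultimately show ?thesis by simp
  qed
  have ds: "map (\<lambda>t. int ?u div int b ^ t mod int b + 1) [0..<m - 1] = map int zs"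
  proof (rule nth_equalityI)
    fix t assume "t < length (map (\<lambda>t. int ?u div int b ^ t mod int b + 1) [0..<m - 1])"
    then have t: "t < m - 1" by simp
    have "int ?u div int b ^ t mod int b + 1 = int (?u div b ^ t mod b + 1)"
      by (simp only: zdiv_int zmod_int of_nat_add of_nat_power of_nat_1)
    then show "map (\<lambda>t. int ?u div int b ^ t mod int b + 1) [0..<m - 1] ! t = map int zs ! t"
      using t lz unfolding dg[OF t] by simp
  qed (simp add: lz)
  have "int ?u div int b ^ (m - 1) = int v"
    by (metis dv of_nat_power zdiv_int)
  then have "tup (int b) m A (int ?u) = map int js"
    unfolding tup_def Let_def ds using v(2) by (simp add: js' sum_list_map_int)
  then show ?thesis using that lt by blast
qed

section \<open>The reduction\<close>

text \<open>
  Array 3 counts the fixed coordinate, array 4 the innermost loops; the given program is moved to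
  arrays 5 and above.
\<close>

definition nE :: iexp where "nE = ILoad 0 (IConst 0)"
definition NE :: iexp where "NE = ILoad 0 (IConst 1)"
definition aE :: iexp where "aE = ILoad 0 (IConst 2)"
definition cE :: iexp where "cE = IAdd (ILoad 3 (IConst 0)) (IConst 1)"
definition uE :: iexp where "uE = ILoad 4 (IConst 0)"

section \<open>Tuples and addresses as program expressions\<close>

primrec powE :: "iexp \<Rightarrow> nat \<Rightarrow> iexp" where
  "powE e 0 = IConst 1"
| "powE e (Suc t) = IMul e (powE e t)"

text \<open>The dimension is a constant of the program text, so a tuple needs no array: each
  coordinate is an expression in the loop counter.\<close>

definition tupE :: "iexp \<Rightarrow> nat \<Rightarrow> iexp \<Rightarrow> iexp list" where
  "tupE b q A = (let ds = map (\<lambda>t. IAdd (IMod (IDiv uE (powE b t)) b) (IConst 1)) [0..<q - 1]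
    in ds @ [ISub (IAdd A (IDiv uE (powE b (q - 1)))) (foldr IAdd ds (IConst 0))])"

definition taddrE :: "iexp \<Rightarrow> iexp list \<Rightarrow> iexp" where
  "taddrE e es = foldl (\<lambda>z j. IAdd (IMul z (IAdd e (IConst 1))) j) (IConst 0) es"

definition rngE :: "iexp \<Rightarrow> iexp list \<Rightarrow> bexp" where
  "rngE e es = foldr (\<lambda>j. BAnd (BAnd (ILess (IConst 0) j) (ILess j (IAdd e (IConst 1))))) es (ILess (IConst 0) (IConst 1))"

lemma ival_powE: "ival s (powE e t) = ival s e ^ t"
  by (induction t) auto

lemma ibd_powE: "ibd M s e \<Longrightarrow> ibd M s (powE e t)"
  by (induction t) auto

lemma ival_foldr_IAdd: "ival s (foldr IAdd es (IConst 0)) = sum_list (map (ival s) es)"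
  by (induction es) auto

lemma ibd_foldr_IAdd: "\<forall>e\<in>set es. ibd M s e \<Longrightarrow> ibd M s (foldr IAdd es (IConst 0))"
  by (induction es) auto

lemma ival_tupE: "map (ival s) (tupE b q A) = tup (ival s b) q (ival s A) (imem s 4 0)"
  by (simp add: tupE_def tup_def Let_def ival_foldr_IAdd ival_powE uE_def o_def)

lemma ibd_tupE: "ibd M s b \<Longrightarrow> ibd M s A \<Longrightarrow> \<bar>imem s 4 0\<bar> \<le> M \<Longrightarrow> \<forall>e\<in>set (tupE b q A). ibd M s e"
  by (auto simp: tupE_def Let_def uE_def intro!: ibd_foldr_IAdd ibd_powE)

lemma ival_taddrE: "ival s (taddrE e es) = taddr (ival s e) (map (ival s) es)"
  by (induction es rule: rev_induct) (auto simp: taddrE_def taddr_def)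

lemma ibd_taddrE: "ibd M s e \<Longrightarrow> \<forall>e\<in>set es. ibd M s e \<Longrightarrow> ibd M s (taddrE e es)"
  by (induction es rule: rev_induct) (auto simp: taddrE_def)

lemma bval_rngE: "bval s (rngE e es) \<longleftrightarrow> (\<forall>i\<in>set (map (ival s) es). 1 \<le> i \<and> i \<le> ival s e)"
  by (induction es) (auto simp: rngE_def)

lemma bbd_rngE: "ibd M s e \<Longrightarrow> \<forall>e\<in>set es. ibd M s e \<Longrightarrow> bbd M s (rngE e es)"
  by (induction es) (auto simp: rngE_def)

lemma bval_rngE_tupE:
  assumes "ival s b = int b'" "1 \<le> b'" "ival s A = \<alpha>" "imem s 4 0 = int u" "u < b' ^ (q - 1) * N" "1 \<le> q"
  shows "bval s (rngE b (tupE b q A)) \<longleftrightarrow>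
    (\<exists>js\<in>band b' q \<alpha> (\<alpha> + int N). tup (int b') q \<alpha> (int u) = map int js)"
  unfolding bval_rngE ival_tupE assms(1,3,4)
proof
  assume "\<forall>i\<in>set (tup (int b') q \<alpha> (int u)). 1 \<le> i \<and> i \<le> int b'"
  then show "\<exists>js\<in>band b' q \<alpha> (\<alpha> + int N). tup (int b') q \<alpha> (int u) = map int js"
    using tup_sound[OF assms(6,2,5)] by metis
qed (fastforce simp: band_def cube_def)

lemma holds_istore [simp]: "r \<noteq> q \<Longrightarrow> holds (istore q i v s) r p y = holds s r p y"
  by (simp add: holds_def istore_def)

text \<open>Progress of a loop that fills a table: \<open>tp\<close> is the enumeration of tuples.
  Counter values that do not encode a tuple of \<open>S\<close> impose nothing.\<close>

definition filled :: "nat \<Rightarrow> nat \<Rightarrow> nat list set \<Rightarrow> (nat list \<Rightarrow> ereal) \<Rightarrow> (nat \<Rightarrow> int list) \<Rightarrow> nat \<Rightarrow> state \<Rightarrow> bool" where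
  "filled r n S F tp u s \<longleftrightarrow> (\<forall>v<u. \<forall>js\<in>S. tp v = map int js \<longrightarrow> holds s r (tab_addr n js) (F js))"

lemma filled_Suc_skip:
  "filled r n S F tp u s \<Longrightarrow> \<not> (\<exists>js\<in>S. tp u = map int js) \<Longrightarrow> filled r n S F tp (Suc u) s"
  by (auto simp: filled_def less_Suc_eq)

lemma filled_Suc:
  assumes "filled r n S F tp u s" "S \<subseteq> cube n q" "ks \<in> S" "tp u = map int ks"
    "\<And>A. A \<noteq> tab_addr n ks \<Longrightarrow> imem s' r A = imem s r A \<and> rmem s' r A = rmem s r A"
    "holds s' r (tab_addr n ks) (F ks)"
  shows "filled r n S F tp (Suc u) s'"
  unfolding filled_def
proof (intro allI impI ballI)
  fix v js assume v: "v < Suc u" "js \<in> S" "tp v = map int js"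
  show "holds s' r (tab_addr n js) (F js)"
  proof (cases "js = ks")
    case False
    have "tab_addr n js \<noteq> tab_addr n ks" using tab_addr_inj[of n js ks q] False v(2) assms(2,3) by blast
    moreover have "v \<noteq> u" using False v(3) assms(4) by (auto simp: inj_map_eq_map)
    ultimately show ?thesis using assms(1,5) v by (auto simp: filled_def holds_def less_Suc_eq)
  qed (use assms(6) in simp)
qed

lemma static_input_agree:
  "agree X s s' \<Longrightarrow> 0 \<notin> X \<Longrightarrow> 1 \<notin> X \<Longrightarrow> static_input q d n N a x T s \<Longrightarrow> static_input q d n N a x T s'"
  unfolding static_input_def holds_def by (simp add: agree_imem agree_rmem)

text \<open>For m = 1 the coordinates a - c, ..., a - c + 2N - 1 of both bands are moved to 1, ...,
  2N, so the band of the call starts at 1. In higher dimension there is no shift.\<close>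

definition offE :: "nat \<Rightarrow> iexp" where
  "offE m = (if m = 1 then ISub (ISub aE cE) (IConst 1) else IConst 0)"

definition sizeE :: "nat \<Rightarrow> iexp" where
  "sizeE m = (if m = 1 then IMul (IConst 2) NE else nE)"

definition startE :: "nat \<Rightarrow> iexp" where
  "startE m = ISub (ISub aE cE) (IMul (IConst (int m)) (offE m))"

section \<open>Program text of the reduction\<close>

definition init_body :: "nat \<Rightarrow> com" where
  "init_body k = (let es = tupE nE k (IAdd aE NE) in Cond (rngE nE es) (IStore 2 (taddrE nE es) (IConst 1)) Skip)"

definition init_com :: "nat \<Rightarrow> com" where
  "init_com k = For 4 (IMul (powE nE (k - 1)) NE) (init_body k)"

text \<open>Only p = 0 and p = m are used. For positions e \<le> m the quotient of e by m is 1
  exactly when e = m, which replaces a conditional expression.\<close>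

definition skipE :: "nat \<Rightarrow> iexp \<Rightarrow> iexp" where
  "skipE p e = (if p = 0 then IAdd e (IConst 1) else IAdd e (IDiv e (IConst (int p))))"

definition vaddrE :: "nat \<Rightarrow> nat \<Rightarrow> iexp \<Rightarrow> iexp \<Rightarrow> iexp \<Rightarrow> iexp \<Rightarrow> iexp \<Rightarrow> iexp" where
  "vaddrE m d e l t i q = IAdd (IMul (IAdd (IMul (IAdd (IMul l (IConst (int m + 1))) t) (IAdd e (IConst 1))) i) (IConst (int d))) q"

text \<open>The counter is itself the target address; division and remainder recover the indices l,
  t, i, q from its row-major form. The slot i = 0, left free by the input format, is visited as
  well.\<close>

definition vec_body :: "nat \<Rightarrow> nat \<Rightarrow> nat \<Rightarrow> com" where
  "vec_body m d p =
    (let q = IMod uE (IConst (int d)); z = IDiv uE (IConst (int d)); b = IAdd (sizeE m) (IConst 1);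
         i = IAdd (IMod z b) (offE m); t = IMod (IDiv z b) (IConst (int m + 1));
         l = skipE p (IDiv (IDiv z b) (IConst (int m + 1)));
         y = RLoad 0 (vaddrE (m + 1) d nE l (skipE p t) i q)
     in Cond (rngE nE [i])
          (Cond (ILess t (IConst 1))
            (RStore 5 uE (RMul y (RLoad 0 (vaddrE (m + 1) d nE l (IConst (int p)) cE q))))
            (RStore 5 uE y))
          (RStore 5 uE (ROfInt (IConst 0))))"

definition vec_com :: "nat \<Rightarrow> nat \<Rightarrow> nat \<Rightarrow> com" where
  "vec_com m d p = For 4 (IMul (IConst (int (m * (m + 1) * d))) (IAdd (sizeE m) (IConst 1))) (vec_body m d p)"

definition shiftE :: "nat \<Rightarrow> iexp list \<Rightarrow> iexp list" where
  "shiftE m es = map (\<lambda>e. IAdd e (offE m)) es"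

definition tab_body :: "nat \<Rightarrow> nat \<Rightarrow> com" where
  "tab_body m p =
    (let es = tupE (sizeE m) m (startE m); A = taddrE (sizeE m) es; A' = taddrE nE (ins p cE (shiftE m es))
     in Cond (rngE (sizeE m) es)
          (Cond (rngE nE (shiftE m es))
            (Seq (IStore 6 A (ILoad 1 A')) (RStore 6 A (RLoad 1 A')))
            (IStore 6 A (IConst 1)))
          Skip)"

definition tab_com :: "nat \<Rightarrow> nat \<Rightarrow> com" where
  "tab_com m p = For 4 (IMul (powE (sizeE m) (m - 1)) NE) (tab_body m p)"

definition par_com :: "nat \<Rightarrow> com" where
  "par_com m = Seq (IStore 5 (IConst 0) (sizeE m)) (Seq (IStore 5 (IConst 1) NE) (IStore 5 (IConst 2) (startE m)))"

text \<open>The guard accepts a finite result if the accumulated minimum is infinite or larger. The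
  negated conjunction in it is a disjunction.\<close>

definition out_body :: "nat \<Rightarrow> nat \<Rightarrow> com" where
  "out_body m p =
    (let es = tupE (sizeE m) m (IAdd (startE m) NE); A = taddrE (sizeE m) es;
         A' = taddrE nE (ins p cE (shiftE m es))
     in Cond (rngE (sizeE m) es)
          (Cond (rngE nE (shiftE m es))
            (Cond (BAnd (ILess (ILoad 7 A) (IConst 1))
                (BNot (BAnd (ILess (ILoad 2 A') (IConst 1)) (BNot (RLess (RLoad 7 A) (RLoad 2 A'))))))
              (Seq (IStore 2 A' (IConst 0)) (RStore 2 A' (RLoad 7 A)))
              Skip)
            Skip)
          Skip)"

definition out_com :: "nat \<Rightarrow> nat \<Rightarrow> com" where
  "out_com m p = For 4 (IMul (powE (sizeE m) (m - 1)) NE) (out_body m p)"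

definition step_com :: "com \<Rightarrow> nat \<Rightarrow> nat \<Rightarrow> nat \<Rightarrow> com" where
  "step_com P m d p =
    Seq (vec_com m d p) (Seq (tab_com m p) (Seq (par_com m) (Seq (cren 5 P) (out_com m p))))"

definition phase_com :: "com \<Rightarrow> nat \<Rightarrow> nat \<Rightarrow> nat \<Rightarrow> com" where
  "phase_com P m d p = For 3 nE (step_com P m d p)"

definition main_com :: "com \<Rightarrow> nat \<Rightarrow> nat \<Rightarrow> com" where
  "main_com P m d = Seq (init_com (m + 1)) (Seq (phase_com P m d m) (phase_com P m d 0))"

text \<open>\<open>K\<close> bounds the sizes of all expressions and \<open>M\<close> all words that occur in them.\<close>

locale reduction =
  fixes m d n N :: nat and a :: int and w x T and B M :: int and K :: nat
  assumes m: "1 \<le> m" and d: "1 \<le> d"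
    and inst: "static_instance (m + 1) d n N a w x T"
    and M2: "2 \<le> M" and MK: "M ^ K \<le> B" and MB: "M \<le> B"
    and nM: "int n \<le> M" and NM: "int N \<le> M" and aM: "\<bar>a\<bar> \<le> M"
begin

definition size :: nat where "size = (if m = 1 then 2 * N else n)"
definition off :: "nat \<Rightarrow> int" where "off c = (if m = 1 then a - int c - 1 else 0)"
definition start :: "nat \<Rightarrow> int" where "start c = a - int c - int m * off c"

text \<open>What holds throughout the round that fixes the coordinate to \<open>c\<close>; loop
  counters start at 0, hence the c - 1 in array 3.\<close>

definition stage :: "nat \<Rightarrow> state \<Rightarrow> bool" where
  "stage c s \<longleftrightarrow> static_input (m + 1) d n N a x T s \<and> words B s \<and> c \<in> {1..n} \<and> imem s 3 0 = int c - 1"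

lemma n1: "1 \<le> n" and N1: "1 \<le> N"
  using inst by (auto simp: static_instance_def)

lemma size1: "1 \<le> size"
  using n1 N1 by (auto simp: size_def)

text \<open>In dimension 1 the only coordinate equals the coordinate sum and is confined to a window
  of length 2N. Otherwise the shift is 0 and the small cube has the original side length.\<close>

lemma cover:
  assumes "ks \<in> band n m (a - int c) (a - int c + 2 * int N)" "i \<in> set ks"
  shows "1 \<le> int i - off c \<and> int i - off c \<le> int size"
proof (cases "m = 1")
  case True
  then obtain j where "ks = [j]" using assms(1) by (auto simp: band_def cube_def length_Suc_conv)
  moreover have "off c = a - int c - 1" "size = 2 * N" using True unfolding off_def size_def by simp_all
  ultimately show ?thesis using assms by (auto simp: band_def)
qed (use assms in \<open>auto simp: band_def cube_def off_def size_def\<close>)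

lemma ival_input:
  assumes "static_input (m + 1) d n N a x T s"
  shows "ival s nE = int n" "ival s NE = int N" "ival s aE = a"
    "ibd M s nE" "ibd M s NE" "ibd M s aE"
  using assms nM NM aM by (auto simp: static_input_def nE_def NE_def aE_def)

lemma ival_stage:
  assumes "stage c s"
  shows "ival s nE = int n" "ival s NE = int N" "ival s cE = int c" "ival s (sizeE m) = int size"
    "ival s (offE m) = off c" "ival s (startE m) = start c"
    "ibd M s nE" "ibd M s NE" "ibd M s cE" "ibd M s (sizeE m)" "ibd M s (offE m)" "ibd M s (startE m)"
proof -
  have "static_input (m + 1) d n N a x T s" using assms by (simp add: stage_def)
  note in1 = ival_input[OF this]
  show c: "ival s cE = int c" "ibd M s cE" using assms nM by (auto simp: stage_def cE_def)
  show "ival s nE = int n" "ival s NE = int N" "ibd M s nE" "ibd M s NE" by fact+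
  show "ival s (sizeE m) = int size" "ibd M s (sizeE m)" using in1 by (auto simp: sizeE_def size_def)
  show o: "ival s (offE m) = off c" "ibd M s (offE m)" using in1 c by (auto simp: offE_def off_def)
  show "ival s (startE m) = start c" "ibd M s (startE m)" using in1 c o by (auto simp: startE_def start_def)
qed

lemma stage_agree: "stage c s \<Longrightarrow> agree X s s' \<Longrightarrow> words B s' \<Longrightarrow> 0 \<notin> X \<Longrightarrow> 1 \<notin> X \<Longrightarrow> 3 \<notin> X \<Longrightarrow> stage c s'"
  unfolding stage_def using static_input_agree[of X s s'] by (simp add: agree_imem)

lemmas ok = iok_if_ibd[OF M2 MK] rok_if_rbd[OF M2 MK] bok_if_bbd[OF M2 MK]

lemma B1: "1 \<le> B" using M2 MB by linarith

section \<open>Initialising the output band with infinity\<close>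

lemma init_body_step:
  assumes s: "static_input (m + 1) d n N a x T s" and u: "imem s 4 0 = int u" "int u \<le> M" "u < n ^ m * N"
    and sz: "csz (init_body (m + 1)) \<le> K"
    and F: "filled 2 n (band n (m + 1) (a + int N) (a + 2 * int N)) (\<lambda>_. \<infinity>) (\<lambda>u. tup (int n) (m + 1) (a + int N) (int u)) u s"
  shows "runs B (init_body (m + 1)) s 2
    (filled 2 n (band n (m + 1) (a + int N) (a + 2 * int N)) (\<lambda>_. \<infinity>) (\<lambda>u. tup (int n) (m + 1) (a + int N) (int u)) (Suc u))"
proof -
  let ?es = "tupE nE (m + 1) (IAdd aE NE)"
  let ?A = "taddrE nE ?es"
  note ev = ival_input[OF s]
  have es: "\<forall>e\<in>set ?es. ibd M s e" using ev u by (intro ibd_tupE) auto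
  have vA: "ival s ?A = taddr (int n) (tup (int n) (m + 1) (a + int N) (int u))"
    using ev u by (simp add: ival_taddrE ival_tupE)
  have 2: "a + 2 * int N = a + int N + int N" by simp
  have iff: "bval s (rngE nE ?es) \<longleftrightarrow>
      (\<exists>js\<in>band n (m + 1) (a + int N) (a + 2 * int N). tup (int n) (m + 1) (a + int N) (int u) = map int js)"
    unfolding 2 by (rule bval_rngE_tupE) (use ev u n1 in auto)
  show ?thesis unfolding init_body_def Let_def
  proof (rule runs_Cond[where K = 1])
    show "bok B s (rngE nE ?es)"
      using sz ev es by (intro ok bbd_rngE) (auto simp: init_body_def Let_def)
    show "runs B Skip s 1 (filled 2 n (band n (m + 1) (a + int N) (a + 2 * int N)) (\<lambda>_. \<infinity>)
        (\<lambda>u. tup (int n) (m + 1) (a + int N) (int u)) (Suc u))" if "\<not> bval s (rngE nE ?es)"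
      using that F iff by (intro runs_Skip filled_Suc_skip) auto
    assume "bval s (rngE nE ?es)"
    then obtain ks where ks: "ks \<in> band n (m + 1) (a + int N) (a + 2 * int N)"
      "tup (int n) (m + 1) (a + int N) (int u) = map int ks" using iff by blast
    have vA': "ival s ?A = tab_addr n ks" using vA ks(2) by (simp add: tab_addr_taddr)
    show "runs B (IStore 2 ?A (IConst 1)) s 1 (filled 2 n (band n (m + 1) (a + int N) (a + 2 * int N)) (\<lambda>_. \<infinity>)
        (\<lambda>u. tup (int n) (m + 1) (a + int N) (int u)) (Suc u))"
    proof (rule runs_IStore)
      show "iok B s ?A" "iok B s (IConst 1)"
        using sz ev es by (intro ok ibd_taddrE; auto simp: init_body_def Let_def)+
      show "filled 2 n (band n (m + 1) (a + int N) (a + 2 * int N)) (\<lambda>_. \<infinity>)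
        (\<lambda>u. tup (int n) (m + 1) (a + int N) (int u)) (Suc u) (istore 2 (ival s ?A) (ival s (IConst 1)) s)"
        unfolding vA' by (rule filled_Suc[OF F _ ks, where q = "m + 1"]) (auto simp: band_def istore_def holds_def)
    qed simp
  qed simp
qed

lemma init_com_runs:
  assumes s: "static_input (m + 1) d n N a x T s" "words B s" and U: "int (n ^ m * N) \<le> M"
    and sz: "csz (init_com (m + 1)) \<le> K"
  shows "runs B (init_com (m + 1)) s (2 + real (n ^ m * N) * 4)
    (\<lambda>s'. (\<forall>js\<in>band n (m + 1) (a + int N) (a + 2 * int N). holds s' 2 (tab_addr n js) \<infinity>)
      \<and> words B s' \<and> agree {2, 4} s s')"
proof -
  let ?S = "band n (m + 1) (a + int N) (a + 2 * int N)"
  let ?tp = "\<lambda>u. tup (int n) (m + 1) (a + int N) (int u)"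
  let ?I = "filled 2 n ?S (\<lambda>_. \<infinity>) ?tp"
  have mods: "mods (init_body q) = {2}" for q by (simp add: init_body_def Let_def)
  have in1: "static_input (m + 1) d n N a x T s'" if "agree {4, 2} s s'" for s'
    using static_input_agree[OF that] s by simp
  have "runs B (init_com (m + 1)) s (2 + real (n ^ m * N) * 4)
    (\<lambda>s'. ?I (n ^ m * N) s' \<and> words B s' \<and> agree (insert 4 (mods (init_body (m + 1)))) s s')"
    unfolding init_com_def
  proof (rule runs_For[where K = 2]; (unfold mods)?)
    fix s' assume "agree {4, 2} s s'"
    note ev = ival_input[OF in1[OF this]]
    then show "ival s' (IMul (powE nE (m + 1 - 1)) NE) = int (n ^ m * N) \<and> iok B s' (IMul (powE nE (m + 1 - 1)) NE)"
      using sz U MB by (auto simp: ival_powE init_com_def For_def intro!: ok ibd_powE)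
  next
    fix u s' assume *: "u < n ^ m * N" "?I u s'" "imem s' 4 0 = int u" "agree {4, 2} s s'"
    have "int u \<le> M" using *(1) U by linarith
    then show "runs B (init_body (m + 1)) s' 2 (?I (Suc u))"
      using * sz by (intro init_body_step in1) (auto simp: init_com_def For_def)
  qed (use s B1 U MB in \<open>auto simp: filled_def\<close>)
  then show ?thesis
  proof (rule runs_mono)
    fix s' assume *: "?I (n ^ m * N) s' \<and> words B s' \<and> agree (insert 4 (mods (init_body (m + 1)))) s s'"
    have "holds s' 2 (tab_addr n js) \<infinity>" if js: "js \<in> ?S" for js
    proof -
      have "js \<in> band n (m + 1) (a + int N) (a + int N + int N)" using js by (simp add: add.assoc)
      then obtain u where "u < n ^ m * N" "?tp u = map int js"
        using tup_complete[of "m + 1" js n "a + int N" N] by auto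
      then show ?thesis using * js by (simp add: filled_def)
    qed
    then show "(\<forall>js\<in>?S. holds s' 2 (tab_addr n js) \<infinity>) \<and> words B s' \<and> agree {2, 4} s s'"
      using * by (simp add: mods insert_commute)
  qed simp
qed

lemma ival_vaddrE:
  assumes "ival s e = int n" "ival s l = int l'" "ival s t = int t'" "ival s i = int i'" "ival s q = int q'"
  shows "ival s (vaddrE q0 d e l t i q) = vec_addr q0 d n l' t' i' q'"
  using assms by (simp add: vaddrE_def vec_addr_def algebra_simps)

lemma ival_skipE:
  assumes "ival s e = int t" "t \<le> m" "p = 0 \<or> p = m"
  shows "ival s (skipE p e) = int (skip p t)"
proof (cases "p = 0")
  case False
  then have "p = m" using assms by simp
  moreover have "int t div int m = (if t = m then 1 else 0)" using assms(2) m by (auto simp: zdiv_int[symmetric])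
  ultimately show ?thesis using assms False by (auto simp: skipE_def skip_def)
qed (use assms in \<open>auto simp: skipE_def skip_def\<close>)

section \<open>Writing the vectors of a call\<close>

definition vec_val :: "nat \<Rightarrow> nat \<Rightarrow> nat \<Rightarrow> real" where
  "vec_val p c u = fixx p c n (off c) x (u div d div (size + 1) div (m + 1)) (u div d div (size + 1) mod (m + 1))
    (u div d mod (size + 1)) (u mod d)"

lemma vec_body_step:
  assumes s: "stage c s" and u: "imem s 4 0 = int u" "int u \<le> M" "u < m * (m + 1) * d * (size + 1)"
    and p: "p = 0 \<or> p = m" and sz: "csz (vec_body m d p) \<le> K"
    and I: "\<forall>v<u. rmem s 5 (int v) = vec_val p c v"
  shows "runs B (vec_body m d p) s 3 (\<lambda>s'. \<forall>v<Suc u. rmem s' 5 (int v) = vec_val p c v)"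
proof -
  define q where "q = IMod uE (IConst (int d))"
  define z where "z = IDiv uE (IConst (int d))"
  define b where "b = IAdd (sizeE m) (IConst 1)"
  define i where "i = IAdd (IMod z b) (offE m)"
  define t where "t = IMod (IDiv z b) (IConst (int m + 1))"
  define l where "l = skipE p (IDiv (IDiv z b) (IConst (int m + 1)))"
  define A where "A = vaddrE (m + 1) d nE l (skipE p t) i q"
  define A0 where "A0 = vaddrE (m + 1) d nE l (IConst (int p)) cE q"
  have body: "vec_body m d p = Cond (rngE nE [i])
          (Cond (ILess t (IConst 1)) (RStore 5 uE (RMul (RLoad 0 A) (RLoad 0 A0))) (RStore 5 uE (RLoad 0 A)))
          (RStore 5 uE (ROfInt (IConst 0)))"
    unfolding vec_body_def Let_def q_def z_def b_def i_def t_def l_def A_def A0_def by (rule refl)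
  define z' where "z' = u div d"
  define i' where "i' = z' mod (size + 1)"
  define t' where "t' = z' div (size + 1) mod (m + 1)"
  define l' where "l' = z' div (size + 1) div (m + 1)"
  define q' where "q' = u mod d"
  have val: "vec_val p c u = fixx p c n (off c) x l' t' i' q'"
    by (simp add: vec_val_def z'_def i'_def t'_def l'_def q'_def)
  \<comment> \<open>The bound on the counter is peeled off digit by digit, so that the leading index
    \<open>l'\<close> is a valid direction.\<close>
  have "z' < m * (m + 1) * (size + 1)"
    unfolding z'_def using u(3) by (intro less_mult_imp_div_less) (simp add: ac_simps)
  then have "z' div (size + 1) < m * (m + 1)" by (intro less_mult_imp_div_less) simp
  then have l': "l' < m" unfolding l'_def by (rule less_mult_imp_div_less)
  have t': "t' \<le> m" unfolding t'_def using mod_less_divisor[of "m + 1"] by (simp add: less_Suc_eq_le)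
  have q': "q' < d" using d by (simp add: q'_def)
  note ev = ival_stage[OF s]
  have vz: "ival s uE = int u" "ival s z = int z'" using u by (simp_all add: uE_def z_def z'_def zdiv_int)
  have vq: "ival s q = int q'" using vz by (simp add: q_def q'_def zmod_int)
  have vb: "ival s b = int (size + 1)" using ev by (simp add: b_def)
  have vzb: "ival s (IDiv z b) = int (z' div (size + 1))" using vz vb by (simp only: ival.simps zdiv_int)
  have vi: "ival s i = int i' + off c" using vz vb ev by (simp add: i_def i'_def zmod_int)
  have m1: "int m + 1 = int (m + 1)" by simp
  have vt: "ival s t = int t'" unfolding t_def t'_def m1 ival.simps(7) vzb by (simp only: ival.simps zmod_int)
  have "ival s (IDiv (IDiv z b) (IConst (int m + 1))) = ival s (IDiv z b) div int (m + 1)" by (simp add: add.commute)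
  also have "\<dots> = int l'" unfolding vzb l'_def by (simp only: zdiv_int)
  finally have vl: "ival s l = int (skip p l')"
    unfolding l_def by (rule ival_skipE[OF _ _ p]) (use l' in simp)
  have vst: "ival s (skipE p t) = int (skip p t')" by (rule ival_skipE[OF vt t' p])
  have bd: "ibd M s uE" "ibd M s q" "ibd M s i" "ibd M s t" "ibd M s l" "ibd M s A" "ibd M s A0"
    using ev u by (auto simp: uE_def q_def i_def t_def l_def A_def A0_def z_def b_def skipE_def vaddrE_def)
  have rng: "bval s (rngE nE [i]) \<longleftrightarrow> inr n (off c) i'" using ev vi by (simp add: bval_rngE inr_def)
  have in1: "static_input (m + 1) d n N a x T s" "c \<in> {1..n}" using s by (simp_all add: stage_def)
  have sk: "skip p l' < m + 1" "skip p t' < m + 2" "p < m + 2" using l' t' p by (auto simp: skip_def)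
  have vA0: "rmem s 0 (ival s A0) = x (skip p l') p c q'"
  proof -
    have "ival s A0 = vec_addr (m + 1) d n (skip p l') p c q'"
      unfolding A0_def by (rule ival_vaddrE) (use ev vl vq in auto)
    then show ?thesis using in1 sk q' by (simp add: static_input_def)
  qed
  have vA: "rmem s 0 (ival s A) = x (skip p l') (skip p t') (un (off c) i') q'" if r: "inr n (off c) i'"
  proof -
    have "ival s A = vec_addr (m + 1) d n (skip p l') (skip p t') (un (off c) i') q'"
      unfolding A_def by (rule ival_vaddrE) (use ev vl vst vq vi int_un[OF r] in auto)
    moreover have "un (off c) i' \<in> {1..n}" using r by (auto simp: inr_def un_def)
    ultimately show ?thesis using in1 sk q' by (simp add: static_input_def)
  qed
  have st: "\<forall>v<Suc u. rmem (rstore 5 (ival s uE) y s) 5 (int v) = vec_val p c v" if "y = vec_val p c u" for y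
    using I that vz by (auto simp: rstore_def less_Suc_eq)
  have sz': "isz uE \<le> K" "isz i \<le> K" "isz t \<le> K" "isz A \<le> K" "isz A0 \<le> K" "bsz (rngE nE [i]) \<le> K" "isz (IConst 1) \<le> K"
    using sz unfolding body by (auto simp: rngE_def)
  show ?thesis unfolding body
  proof (rule runs_Cond[where K = 2])
    show "bok B s (rngE nE [i])" using ev bd sz' by (intro ok bbd_rngE) auto
    assume r: "bval s (rngE nE [i])"
    then have r': "inr n (off c) i'" using rng by simp
    show "runs B (Cond (ILess t (IConst 1)) (RStore 5 uE (RMul (RLoad 0 A) (RLoad 0 A0))) (RStore 5 uE (RLoad 0 A)))
      s 2 (\<lambda>s'. \<forall>v<Suc u. rmem s' 5 (int v) = vec_val p c v)"
    proof (rule runs_Cond[where K = 1])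
      show "bok B s (ILess t (IConst 1))" using bd sz' by (intro ok) auto
      assume "bval s (ILess t (IConst 1))"
      then have "t' = 0" using vt by simp
      then show "runs B (RStore 5 uE (RMul (RLoad 0 A) (RLoad 0 A0))) s 1 (\<lambda>s'. \<forall>v<Suc u. rmem s' 5 (int v) = vec_val p c v)"
        using bd sz' r' vA[OF r'] vA0 by (intro runs_RStore ok st) (auto simp: val fixx_def)
    next
      assume "\<not> bval s (ILess t (IConst 1))"
      then have "t' \<noteq> 0" using vt by simp
      then show "runs B (RStore 5 uE (RLoad 0 A)) s 1 (\<lambda>s'. \<forall>v<Suc u. rmem s' 5 (int v) = vec_val p c v)"
        using bd sz' r' vA[OF r'] by (intro runs_RStore ok st) (auto simp: val fixx_def)
    qed simp
  next
    assume "\<not> bval s (rngE nE [i])"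
    then show "runs B (RStore 5 uE (ROfInt (IConst 0))) s 2 (\<lambda>s'. \<forall>v<Suc u. rmem s' 5 (int v) = vec_val p c v)"
      using bd sz' rng by (intro runs_RStore ok st) (auto simp: val fixx_def)
  qed simp
qed

lemma vec_val_addr:
  assumes "i \<le> size" "t \<le> m" "q < d"
  shows "vec_val p c (((l * (m + 1) + t) * (size + 1) + i) * d + q) = fixx p c n (off c) x l t i q"
proof -
  let ?u = "((l * (m + 1) + t) * (size + 1) + i) * d + q"
  have 1: "?u div d = (l * (m + 1) + t) * (size + 1) + i" "?u mod d = q"
    using assms(3) by simp_all
  have 2: "((l * (m + 1) + t) * (size + 1) + i) div (size + 1) = l * (m + 1) + t"
    "((l * (m + 1) + t) * (size + 1) + i) mod (size + 1) = i"
    using assms(1) by (simp_all del: add_Suc_right add_Suc mult_Suc_right mult_Suc)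
  have 3: "(l * (m + 1) + t) div (m + 1) = l" "(l * (m + 1) + t) mod (m + 1) = t"
    using assms(2) by (simp_all del: add_Suc_right add_Suc mult_Suc_right mult_Suc)
  show ?thesis unfolding vec_val_def 1 2 3 ..
qed

lemma vec_com_runs:
  assumes s: "stage c s" and p: "p = 0 \<or> p = m" and U: "int (m * (m + 1) * d * (size + 1)) \<le> M"
    and sz: "csz (vec_com m d p) \<le> K"
  shows "runs B (vec_com m d p) s (2 + real (m * (m + 1) * d * (size + 1)) * 5)
    (\<lambda>s'. (\<forall>l<m. \<forall>t<m + 1. \<forall>i\<in>{1..size}. \<forall>q<d. rmem s' 5 (vec_addr m d size l t i q) = fixx p c n (off c) x l t i q)
      \<and> words B s' \<and> agree {4, 5} s s')"
proof -
  let ?I = "\<lambda>u s'. \<forall>v<u. rmem s' 5 (int v) = vec_val p c v"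
  let ?U = "m * (m + 1) * d * (size + 1)"
  let ?E = "IMul (IConst (int (m * (m + 1) * d))) (IAdd (sizeE m) (IConst 1))"
  have mods: "mods (vec_body m d p) = {5}" by (simp add: vec_body_def Let_def)
  have st: "stage c s'" if "agree {4, 5} s s'" "words B s'" for s' using stage_agree[OF s that] by simp
  have "runs B (vec_com m d p) s (2 + real ?U * 5)
    (\<lambda>s'. ?I ?U s' \<and> words B s' \<and> agree (insert 4 (mods (vec_body m d p))) s s')"
    unfolding vec_com_def
  proof (rule runs_For[where K = 3 and I = ?I and U = ?U]; (unfold mods)?)
    show w: "words B s" using s by (simp add: stage_def)
    fix s' assume *: "agree {4, 5} s s'"
    have "static_input (m + 1) d n N a x T s'" using static_input_agree[OF *] s by (simp add: stage_def)
    then have "ival s' (sizeE m) = int size \<and> ibd M s' (sizeE m)"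
      using ival_input[of s'] by (auto simp: sizeE_def size_def)
    then have **: "ival s' ?E = int ?U" "ibd M s' ?E" by (simp_all add: algebra_simps)
    show "ival s' ?E = int ?U \<and> iok B s' ?E"
      using **(1) ok(1)[OF **(2)] sz by (simp add: vec_com_def For_def)
  next
    fix u s' assume *: "u < ?U" "?I u s'" "words B s'" "imem s' 4 0 = int u" "agree {4, 5} s s'"
    have "int u \<le> M" using *(1) U by linarith
    then show "runs B (vec_body m d p) s' 3 (?I (Suc u))"
      using * sz p by (intro vec_body_step st) (auto simp: vec_com_def For_def)
  qed (use B1 U MB in \<open>auto simp: istore_def\<close>)
  then show ?thesis
  proof (rule runs_mono)
    fix s' assume *: "?I ?U s' \<and> words B s' \<and> agree (insert 4 (mods (vec_body m d p))) s s'"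
    have "rmem s' 5 (vec_addr m d size l t i q) = fixx p c n (off c) x l t i q"
      if "l < m" "t < m + 1" "i \<in> {1..size}" "q < d" for l t i q
    proof -
      \<comment> \<open>Mixed-radix bound: a number with valid digits stays below the product of the
        radices. It is applied once per index to see that every required address is visited.\<close>
      have le: "x * y + z < w * y" if "x + 1 \<le> w" "z < y" for w x y z :: nat
      proof -
        have "(x + 1) * y \<le> w * y" using that(1) by (rule mult_le_mono1)
        then show ?thesis using that(2) by simp
      qed
      have "l * (m + 1) + t < m * (m + 1)" by (rule le) (use that in auto)
      then have "(l * (m + 1) + t) * (size + 1) + i < m * (m + 1) * (size + 1)" by (intro le) (use that in auto)
      then have "((l * (m + 1) + t) * (size + 1) + i) * d + q < m * (m + 1) * (size + 1) * d"
        by (intro le) (use that in auto)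
      then have "((l * (m + 1) + t) * (size + 1) + i) * d + q < ?U" by (simp add: ac_simps)
      then have "rmem s' 5 (vec_addr m d size l t i q) = vec_val p c (((l * (m + 1) + t) * (size + 1) + i) * d + q)"
        using * unfolding vec_addr_def by blast
      then show ?thesis using that by (subst vec_val_addr[symmetric]) auto
    qed
    then show "(\<forall>l<m. \<forall>t<m + 1. \<forall>i\<in>{1..size}. \<forall>q<d. rmem s' 5 (vec_addr m d size l t i q) = fixx p c n (off c) x l t i q)
      \<and> words B s' \<and> agree {4, 5} s s'"
      using * by (simp add: mods)
  qed simp
qed

section \<open>Evaluation of tuples, and the table values of a call\<close>

lemma tuple_eval:
  assumes s: "stage c s" and u: "imem s 4 0 = int u" "int u \<le> M"
    and A: "ival s A = \<alpha>" "ibd M s A"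
  defines "es \<equiv> tupE (sizeE m) m A"
  shows "\<forall>e\<in>set es. ibd M s e" "bbd M s (rngE (sizeE m) es)" "bbd M s (rngE nE (shiftE m es))"
    "ibd M s (taddrE (sizeE m) es)" "ibd M s (taddrE nE (ins p cE (shiftE m es)))"
    "tup (int size) m \<alpha> (int u) = map int ks \<Longrightarrow> ival s (taddrE (sizeE m) es) = tab_addr size ks"
    "tup (int size) m \<alpha> (int u) = map int ks \<Longrightarrow>
      bval s (rngE nE (shiftE m es)) \<longleftrightarrow> (\<forall>i\<in>set ks. inr n (off c) i)"
    "tup (int size) m \<alpha> (int u) = map int ks \<Longrightarrow> \<forall>i\<in>set ks. inr n (off c) i \<Longrightarrow>
      ival s (taddrE nE (ins p cE (shiftE m es))) = tab_addr n (ins p c (map (un (off c)) ks))"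
proof -
  note ev = ival_stage[OF s]
  show b: "\<forall>e\<in>set es. ibd M s e"
    unfolding es_def using ev u A by (intro ibd_tupE) auto
  have b': "\<forall>e\<in>set (shiftE m es). ibd M s e" using b ev by (auto simp: shiftE_def)
  show "bbd M s (rngE (sizeE m) es)" "bbd M s (rngE nE (shiftE m es))"
    "ibd M s (taddrE (sizeE m) es)" "ibd M s (taddrE nE (ins p cE (shiftE m es)))"
    using b b' ev by (auto intro!: bbd_rngE ibd_taddrE)
  assume ks: "tup (int size) m \<alpha> (int u) = map int ks"
  have v: "map (ival s) es = map int ks" unfolding es_def ival_tupE using ev u A ks by simp
  then show "ival s (taddrE (sizeE m) es) = tab_addr size ks"
    using ev by (simp add: ival_taddrE tab_addr_taddr)
  have "map (ival s) (shiftE m es) = map (\<lambda>i. i + off c) (map (ival s) es)"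
    using ev by (simp add: shiftE_def)
  then have v': "map (ival s) (shiftE m es) = map (\<lambda>i. int i + off c) ks" unfolding v by (simp add: o_def)
  show "bval s (rngE nE (shiftE m es)) \<longleftrightarrow> (\<forall>i\<in>set ks. inr n (off c) i)"
    unfolding bval_rngE v' using ev by (simp add: inr_def)
  assume r: "\<forall>i\<in>set ks. inr n (off c) i"
  have eq: "map (\<lambda>i. int i + off c) ks = map int (map (un (off c)) ks)"
    using r by (auto simp: int_un)
  show "ival s (taddrE nE (ins p cE (shiftE m es))) = tab_addr n (ins p c (map (un (off c)) ks))"
    unfolding ival_taddrE map_ins v' eq using ev by (simp add: tab_addr_taddr map_ins del: map_map)
qed

lemma stage_istore: "stage c s \<Longrightarrow> q \<notin> {0, 1, 3} \<Longrightarrow> \<bar>v\<bar> \<le> B \<Longrightarrow> stage c (istore q i v s)"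
  by (rule stage_agree[of c s "{q}"]) (auto simp: stage_def agree_def istore_def words_def)

abbreviation "in_band c \<equiv> band size m (start c) (start c + int N)"
abbreviation "in_tup c u \<equiv> tup (int size) m (start c) (int u)"

lemma ins_un_band:
  assumes "ks \<in> band size m (start c + \<alpha>) (start c + \<beta>)" "\<forall>i\<in>set ks. inr n (off c) i" "c \<in> {1..n}"
  shows "ins p c (map (un (off c)) ks) \<in> band n (m + 1) (a + \<alpha>) (a + \<beta>)"
  using ins_band[OF un_band[OF assms(1,2)] assms(3), of p] by (simp add: start_def algebra_simps)

lemma tab_body_step:
  assumes s: "stage c s" and u: "imem s 4 0 = int u" "int u \<le> M" "u < size ^ (m - 1) * N"
    and p: "p = 0 \<or> p = m" and sz: "csz (tab_body m p) \<le> K"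
    and F: "filled 6 size (in_band c) (fixT p c n (off c) T) (in_tup c) u s"
  shows "runs B (tab_body m p) s 4 (filled 6 size (in_band c) (fixT p c n (off c) T) (in_tup c) (Suc u))"
proof -
  let ?F = "filled 6 size (in_band c) (fixT p c n (off c) T) (in_tup c) (Suc u)"
  define es where "es = tupE (sizeE m) m (startE m)"
  define A where "A = taddrE (sizeE m) es"
  define A' where "A' = taddrE nE (ins p cE (shiftE m es))"
  have body: "tab_body m p = Cond (rngE (sizeE m) es)
          (Cond (rngE nE (shiftE m es))
            (Seq (IStore 6 A (ILoad 1 A')) (RStore 6 A (RLoad 1 A')))
            (IStore 6 A (IConst 1)))
          Skip"
    unfolding tab_body_def Let_def es_def A_def A'_def by (rule refl)
  have sz': "isz A \<le> K" "isz A' + 1 \<le> K" "bsz (rngE nE (shiftE m es)) \<le> K" "bsz (rngE (sizeE m) es) \<le> K" "isz (IConst 1) \<le> K"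
    using sz unfolding body by (auto simp: rngE_def)
  note ev = ival_stage[OF s]
  note te0 = tuple_eval[OF s u(1,2) ev(6,12), folded es_def, folded A_def]
  note te = te0(1-4) te0(5)[where p = p, folded A'_def] te0(6,7) te0(8)[where p = p, folded A'_def]
  have c: "c \<in> {1..n}" using s by (simp add: stage_def)
  have iff: "bval s (rngE (sizeE m) es) \<longleftrightarrow> (\<exists>js\<in>in_band c. in_tup c u = map int js)"
    unfolding es_def by (rule bval_rngE_tupE) (use ev u size1 m in auto)
  show ?thesis unfolding body
  proof (rule runs_Cond[where K = 3])
    show "bok B s (rngE (sizeE m) es)" using te sz' by (intro ok)
    show "runs B Skip s 3 ?F" if "\<not> bval s (rngE (sizeE m) es)"
      using that F iff by (intro runs_Skip filled_Suc_skip) auto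
    assume "bval s (rngE (sizeE m) es)"
    then obtain ks where ks: "ks \<in> in_band c" "in_tup c u = map int ks" using iff by blast
    have vA: "ival s A = tab_addr size ks" using te(6)[OF ks(2)] .
    have rng: "bval s (rngE nE (shiftE m es)) \<longleftrightarrow> (\<forall>i\<in>set ks. inr n (off c) i)" using te(7)[OF ks(2)] .
    have upd: "?F s'" if "\<And>P. P \<noteq> tab_addr size ks \<Longrightarrow> imem s' 6 P = imem s 6 P \<and> rmem s' 6 P = rmem s 6 P"
      "holds s' 6 (tab_addr size ks) (fixT p c n (off c) T ks)" for s'
      by (rule filled_Suc[OF F _ ks, where q = m]) (use that in \<open>auto simp: band_def\<close>)
    show "runs B (Cond (rngE nE (shiftE m es))
            (Seq (IStore 6 A (ILoad 1 A')) (RStore 6 A (RLoad 1 A')))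
            (IStore 6 A (IConst 1))) s 3 ?F"
    proof (rule runs_Cond[where K = 2])
      show "bok B s (rngE nE (shiftE m es))" using te sz' by (intro ok)
      show "runs B (IStore 6 A (IConst 1)) s 2 ?F" if r: "\<not> bval s (rngE nE (shiftE m es))"
      proof (rule runs_IStore)
        show "iok B s A" "iok B s (IConst 1)" using te sz' by (intro ok; simp)+
        show "?F (istore 6 (ival s A) (ival s (IConst 1)) s)" unfolding vA
          by (rule upd) (use r rng in \<open>auto simp: istore_def holds_def fixT_def\<close>)
      qed simp
      assume "bval s (rngE nE (shiftE m es))"
      then have r: "\<forall>i\<in>set ks. inr n (off c) i" using rng by simp
      let ?P = "tab_addr n (ins p c (map (un (off c)) ks))"
      have vA': "ival s A' = ?P" using te(8)[OF ks(2) r] .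
      have "ins p c (map (un (off c)) ks) \<in> band n (m + 1) a (a + int N)"
        using ins_un_band[of ks c 0 "int N" p] ks r c by simp
      then have h: "holds s 1 ?P (fixT p c n (off c) T ks)"
        using s r by (simp add: stage_def static_input_def fixT_def)
      \<comment> \<open>In general a memory word is only known to be at most \<open>B\<close>; a
        flag is 0 or 1 and hence may be loaded within the budget \<open>M\<close>.\<close>
      then have fl: "\<bar>imem s 1 ?P\<bar> \<le> M" using M2 by (auto simp: holds_def)
      define s1 where "s1 = istore 6 (tab_addr size ks) (imem s 1 ?P) s"
      have s1: "stage c s1" "imem s1 4 0 = int u"
        using stage_istore[OF s] fl MB u by (auto simp: s1_def istore_def)
      \<comment> \<open>The addresses are evaluated again after the flag has been stored, so the
        evaluation facts are needed in the new state too.\<close>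
      note ev1 = ival_stage[OF s1(1)]
      note te10 = tuple_eval[OF s1 u(2) ev1(6,12), folded es_def, folded A_def]
      note te1 = te10(1-4) te10(5)[where p = p, folded A'_def] te10(6,7) te10(8)[where p = p, folded A'_def]
      show "runs B (Seq (IStore 6 A (ILoad 1 A')) (RStore 6 A (RLoad 1 A'))) s 2 ?F"
      proof (rule runs_Seq[where R = "\<lambda>s'. s' = s1"])
        show "runs B (IStore 6 A (ILoad 1 A')) s 1 (\<lambda>s'. s' = s1)"
        proof (rule runs_IStore)
          show "iok B s A" "iok B s (ILoad 1 A')" using te sz' fl vA' by (intro ok; simp)+
        qed (simp_all add: s1_def vA vA')
        fix s' assume s': "s' = s1"
        show "runs B (RStore 6 A (RLoad 1 A')) s' 1 ?F" unfolding s'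
        proof (rule runs_RStore)
          show "iok B s1 A" "rok B s1 (RLoad 1 A')" using te1 sz' by (intro ok; simp)+
          have "ival s1 A = tab_addr size ks" "rval s1 (RLoad 1 A') = rmem s 1 ?P"
            using te1(6)[OF ks(2)] te1(8)[OF ks(2) r] by (simp_all add: s1_def istore_def)
          then show "?F (rstore 6 (ival s1 A) (rval s1 (RLoad 1 A')) s1)"
            by (intro upd) (use h in \<open>auto simp: s1_def istore_def rstore_def holds_def\<close>)
        qed simp
      qed simp
    qed simp
  qed simp
qed

lemma ival_count:
  assumes "static_input (m + 1) d n N a x T s"
  shows "ival s (IMul (powE (sizeE m) (m - 1)) NE) = int (size ^ (m - 1) * N)"
    "ibd M s (IMul (powE (sizeE m) (m - 1)) NE)"
proof -
  have "ival s (sizeE m) = int size" "ibd M s (sizeE m)"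
    using ival_input[OF assms] by (auto simp: sizeE_def size_def)
  then show "ival s (IMul (powE (sizeE m) (m - 1)) NE) = int (size ^ (m - 1) * N)"
    "ibd M s (IMul (powE (sizeE m) (m - 1)) NE)"
    using ival_input[OF assms] by (auto simp: ival_powE intro: ibd_powE)
qed

lemma tab_com_runs:
  assumes s: "stage c s" and p: "p = 0 \<or> p = m" and U: "int (size ^ (m - 1) * N) \<le> M"
    and sz: "csz (tab_com m p) \<le> K"
  shows "runs B (tab_com m p) s (2 + real (size ^ (m - 1) * N) * 6)
    (\<lambda>s'. (\<forall>js\<in>in_band c. holds s' 6 (tab_addr size js) (fixT p c n (off c) T js))
      \<and> words B s' \<and> agree {4, 6} s s')"
proof -
  let ?I = "filled 6 size (in_band c) (fixT p c n (off c) T) (in_tup c)"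
  let ?U = "size ^ (m - 1) * N"
  have mods: "mods (tab_body m p) = {6}" by (simp add: tab_body_def Let_def)
  have "runs B (tab_com m p) s (2 + real ?U * 6)
    (\<lambda>s'. ?I ?U s' \<and> words B s' \<and> agree (insert 4 (mods (tab_body m p))) s s')"
    unfolding tab_com_def
  proof (rule runs_For[where K = 4 and I = ?I and U = ?U]; (unfold mods)?)
    show "words B s" using s by (simp add: stage_def)
    show "ival s' (IMul (powE (sizeE m) (m - 1)) NE) = int ?U \<and> iok B s' (IMul (powE (sizeE m) (m - 1)) NE)"
      if "agree {4, 6} s s'" for s'
    proof -
      have "static_input (m + 1) d n N a x T s'" using static_input_agree[OF that] s by (simp add: stage_def)
      moreover have "isz (IMul (powE (sizeE m) (m - 1)) NE) \<le> K"
        using sz by (auto simp: tab_com_def For_def)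
      ultimately show ?thesis using ival_count ok(1) by blast
    qed
  next
    fix u s' assume *: "u < ?U" "?I u s'" "words B s'" "imem s' 4 0 = int u" "agree {4, 6} s s'"
    have "int u \<le> M" using *(1) U by linarith
    then show "runs B (tab_body m p) s' 4 (?I (Suc u))"
      using * sz p stage_agree[OF s *(5,3)] by (intro tab_body_step) (auto simp: tab_com_def For_def)
  qed (use B1 U MB in \<open>auto simp: filled_def\<close>)
  then show ?thesis
  proof (rule runs_mono)
    fix s' assume *: "?I ?U s' \<and> words B s' \<and> agree (insert 4 (mods (tab_body m p))) s s'"
    have "holds s' 6 (tab_addr size js) (fixT p c n (off c) T js)" if js: "js \<in> in_band c" for js
      using tup_complete[OF m js] * js unfolding filled_def by blast
    then show "(\<forall>js\<in>in_band c. holds s' 6 (tab_addr size js) (fixT p c n (off c) T js))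
      \<and> words B s' \<and> agree {4, 6} s s'"
      using * by (simp add: mods)
  qed simp
qed

section \<open>Merging the results of a call into the output\<close>

abbreviation "fix_out_band c \<equiv> band size m (start c + int N) (start c + 2 * int N)"
abbreviation "out_tup c u \<equiv> tup (int size) m (start c + int N) (int u)"
abbreviation "out_band \<equiv> band n (m + 1) (a + int N) (a + 2 * int N)"
abbreviation "fix_value p c \<equiv>
  static_value m size N (start c) (fixw p c n (off c) w) (fixT p c n (off c) T)"

text \<open>The entries of the original output band that the merging loop has handled before counter
  value \<open>u\<close>.\<close>

definition touched :: "nat \<Rightarrow> nat \<Rightarrow> nat \<Rightarrow> nat list set" where
  "touched p c u = {ins p c (map (un (off c)) ks) | ks v.
    v < u \<and> ks \<in> fix_out_band c \<and> out_tup c v = map int ks \<and> (\<forall>i\<in>set ks. inr n (off c) i)}"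

definition updated :: "nat \<Rightarrow> nat list set \<Rightarrow> (nat list \<Rightarrow> ereal) \<Rightarrow> state \<Rightarrow> bool" where
  "updated p S acc s \<longleftrightarrow> (\<forall>js\<in>out_band. holds s 2 (tab_addr n js)
    (if js \<in> S then min (acc js) (part_value p m n N a w T js) else acc js))"

lemma touched_Suc:
  assumes "ks \<in> fix_out_band c" "out_tup c u = map int ks" "\<forall>i\<in>set ks. inr n (off c) i"
  shows "touched p c (Suc u) = insert (ins p c (map (un (off c)) ks)) (touched p c u)"
proof -
  have "ks' = ks" if "out_tup c u = map int ks'" for ks'
    using that assms(2) by (simp add: inj_map_eq_map)
  then show ?thesis using assms unfolding touched_def by (auto simp: less_Suc_eq)
qed

lemma touched_Suc_skip:
  assumes "\<not> (\<exists>ks\<in>fix_out_band c. out_tup c u = map int ks \<and> (\<forall>i\<in>set ks. inr n (off c) i))"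
  shows "touched p c (Suc u) = touched p c u"
  using assms unfolding touched_def by (auto simp: less_Suc_eq)

text \<open>Removing coordinate \<open>p\<close> from such a tuple and shifting the rest gives, by
  \<open>cover\<close>, a tuple of the small output band, and the enumeration reaches it. So the
  calls for different \<open>c\<close> treat disjoint parts of the output.\<close>

lemma touched_all:
  assumes p: "p \<le> m" and c: "c \<in> {1..n}"
  shows "touched p c (size ^ (m - 1) * N) = {js \<in> out_band. js ! p = c}"
proof (intro equalityI subsetI)
  fix js assume "js \<in> touched p c (size ^ (m - 1) * N)"
  then obtain ks where ks: "js = ins p c (map (un (off c)) ks)" "ks \<in> fix_out_band c" "\<forall>i\<in>set ks. inr n (off c) i"
    unfolding touched_def by blast
  have "length ks = m" using ks by (simp add: band_def cube_def)
  then show "js \<in> {js \<in> out_band. js ! p = c}"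
    using ins_un_band[OF ks(2,3) c, of p] ks(1) p by (simp add: ins_nth)
next
  fix js assume "js \<in> {js \<in> out_band. js ! p = c}"
  then have js: "js \<in> out_band" "js ! p = c" by auto
  then have len: "length js = m + 1" by (simp add: band_def cube_def)
  define zs where "zs = take p js @ drop (Suc p) js"
  have js_eq: "js = ins p c zs" using ins_remove[of p js] len p js(2) by (simp add: zs_def)
  have zl: "length zs = m" using len p by (simp add: zs_def)
  have "set zs \<subseteq> {1..n}" using js(1) unfolding js_eq by (simp add: band_def cube_def)
  then have zb: "zs \<in> band n m (a - int c + int N) (a - int c + 2 * int N)"
    using js(1) zl unfolding js_eq by (auto simp: band_def cube_def)
  then have "zs \<in> band n m (a - int c) (a - int c + 2 * int N)" by (auto simp: band_def)
  note cov = cover[OF this]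
  define ks where "ks = map (\<lambda>i. nat (int i - off c)) zs"
  have r: "\<forall>i\<in>set ks. inr n (off c) i"
    using cov \<open>set zs \<subseteq> {1..n}\<close> by (fastforce simp: ks_def inr_def)
  have uk: "map (un (off c)) ks = zs"
    unfolding ks_def map_map by (rule map_idI) (use cov in \<open>force simp: un_def\<close>)
  have "ks \<in> cube size m" using cov zl by (force simp: cube_def ks_def)
  moreover have "int (sum_list zs) = int (sum_list ks) + int m * off c"
    using sum_un[OF r] uk zl by (simp add: ks_def)
  ultimately have kb: "ks \<in> fix_out_band c" using zb by (auto simp: band_def start_def)
  then have "ks \<in> band size m (start c + int N) (start c + int N + int N)" by (simp add: add.assoc)
  then obtain v where "v < size ^ (m - 1) * N" "out_tup c v = map int ks" using tup_complete[OF m] by metis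
  then show "js \<in> touched p c (size ^ (m - 1) * N)"
    unfolding touched_def js_eq using kb r uk by blast
qed

text \<open>The minimum is idempotent, so the update is correct even if the tuple had been handled
  before.\<close>

lemma updated_insert:
  assumes I: "updated p S acc s" and js: "js \<in> out_band"
    and eq: "\<And>P. P \<noteq> tab_addr n js \<Longrightarrow> imem s' 2 P = imem s 2 P \<and> rmem s' 2 P = rmem s 2 P"
    and h: "\<And>y. holds s 2 (tab_addr n js) y \<Longrightarrow> holds s' 2 (tab_addr n js) (min y (part_value p m n N a w T js))"
  shows "updated p (insert js S) acc s'"
  unfolding updated_def
proof
  fix ks assume ks: "ks \<in> out_band"
  let ?V = "part_value p m n N a w T"
  have k: "holds s 2 (tab_addr n ks) (if ks \<in> S then min (acc ks) (?V ks) else acc ks)"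
    using I ks by (simp add: updated_def)
  show "holds s' 2 (tab_addr n ks) (if ks \<in> insert js S then min (acc ks) (?V ks) else acc ks)"
  proof (cases "ks = js")
    case True
    then show ?thesis using h[OF k[unfolded True]] by (simp add: min.assoc split: if_splits)
  next
    case False
    then have "tab_addr n ks \<noteq> tab_addr n js"
      using tab_addr_inj[of n ks js "m + 1"] ks js by (auto simp: band_def)
    then show ?thesis using k eq False by (simp add: holds_def)
  qed
qed

lemma out_body_step:
  assumes s: "stage c s" and u: "imem s 4 0 = int u" "int u \<le> M" "u < size ^ (m - 1) * N"
    and p: "p \<le> m" and sz: "csz (out_body m p) \<le> K"
    and H: "\<forall>ks\<in>fix_out_band c. holds s 7 (tab_addr size ks) (fix_value p c ks)"
    and I: "updated p (touched p c u) acc s"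
  shows "runs B (out_body m p) s 5 (updated p (touched p c (Suc u)) acc)"
proof -
  let ?F = "updated p (touched p c (Suc u)) acc"
  define es where "es = tupE (sizeE m) m (IAdd (startE m) NE)"
  define A where "A = taddrE (sizeE m) es"
  define A' where "A' = taddrE nE (ins p cE (shiftE m es))"
  define g where "g = BAnd (ILess (ILoad 7 A) (IConst 1))
                (BNot (BAnd (ILess (ILoad 2 A') (IConst 1)) (BNot (RLess (RLoad 7 A) (RLoad 2 A')))))"
  have body: "out_body m p = Cond (rngE (sizeE m) es)
          (Cond (rngE nE (shiftE m es))
            (Cond g (Seq (IStore 2 A' (IConst 0)) (RStore 2 A' (RLoad 7 A))) Skip) Skip) Skip"
    unfolding out_body_def Let_def es_def A_def A'_def g_def by (rule refl)
  have szg: "bsz (rngE nE (shiftE m es)) \<le> K" "bsz (rngE (sizeE m) es) \<le> K" "isz (IConst 0) \<le> K" "bsz g \<le> K"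
    using sz unfolding body csz.simps max.bounded_iff by blast+
  have "isz A + 1 \<le> K" "isz A' + 1 \<le> K"
    using szg(4) unfolding g_def bsz.simps isz.simps rsz.simps max.bounded_iff by blast+
  note sz' = this szg
  note ev = ival_stage[OF s]
  have alpha: "ival s (IAdd (startE m) NE) = start c + int N" "ibd M s (IAdd (startE m) NE)" using ev by simp_all
  note te0 = tuple_eval[OF s u(1,2) alpha, folded es_def, folded A_def]
  note te = te0(1-4) te0(5)[where p = p, folded A'_def] te0(6,7) te0(8)[where p = p, folded A'_def]
  have c: "c \<in> {1..n}" using s by (simp add: stage_def)
  have iff: "bval s (rngE (sizeE m) es) \<longleftrightarrow> (\<exists>js\<in>fix_out_band c. out_tup c u = map int js)"
  proof -
    have "start c + 2 * int N = start c + int N + int N" by simp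
    then show ?thesis unfolding es_def by (simp only:) (rule bval_rngE_tupE; use ev u size1 m in simp)
  qed
  show ?thesis unfolding body
  proof (rule runs_Cond[where K = 4])
    show "bok B s (rngE (sizeE m) es)" using te sz' by (intro ok)
    show "runs B Skip s 4 ?F" if "\<not> bval s (rngE (sizeE m) es)"
      using that I iff by (intro runs_Skip) (auto simp: touched_Suc_skip)
    assume "bval s (rngE (sizeE m) es)"
    then obtain ks where ks: "ks \<in> fix_out_band c" "out_tup c u = map int ks" using iff by blast
    have vA: "ival s A = tab_addr size ks" using te(6)[OF ks(2)] .
    have rng: "bval s (rngE nE (shiftE m es)) \<longleftrightarrow> (\<forall>i\<in>set ks. inr n (off c) i)" using te(7)[OF ks(2)] .
    show "runs B (Cond (rngE nE (shiftE m es))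
            (Cond g (Seq (IStore 2 A' (IConst 0)) (RStore 2 A' (RLoad 7 A))) Skip) Skip) s 4 ?F"
    proof (rule runs_Cond[where K = 3])
      show "bok B s (rngE nE (shiftE m es))" using te sz' by (intro ok)
      show "runs B Skip s 3 ?F" if "\<not> bval s (rngE nE (shiftE m es))"
      proof -
        have "\<not> (\<exists>ks\<in>fix_out_band c. out_tup c u = map int ks \<and> (\<forall>i\<in>set ks. inr n (off c) i))"
          using that rng ks(2) by (auto simp: inj_map_eq_map)
        then show ?thesis using I by (intro runs_Skip) (auto simp: touched_Suc_skip)
      qed
      assume "bval s (rngE nE (shiftE m es))"
      then have r: "\<forall>i\<in>set ks. inr n (off c) i" using rng by simp
      define js where "js = ins p c (map (un (off c)) ks)"
      let ?V = "part_value p m n N a w T js"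
      have vA': "ival s A' = tab_addr n js" using te(8)[OF ks(2) r] by (simp add: js_def)
      have js: "js \<in> out_band" using ins_un_band[OF ks(1) r c] by (simp add: js_def)
      \<comment> \<open>The point where the answer of the small instance becomes a partial minimum
        of the original one.\<close>
      have "fix_value p c ks = ?V"
        unfolding start_def js_def
        by (rule fix_static_value[OF cover p _ r]) (use ks in \<open>auto simp: band_def\<close>)
      then have h7: "holds s 7 (tab_addr size ks) ?V" using H ks(1) by metis
      obtain y where y: "holds s 2 (tab_addr n js) y" using I js unfolding updated_def by blast
      have fl: "\<bar>imem s 2 (tab_addr n js)\<bar> \<le> M" "\<bar>imem s 7 (tab_addr size ks)\<bar> \<le> M"
        using y h7 M2 by (auto simp: holds_def)
      \<comment> \<open>A flag and a real represent one value only, so the accumulated minimum can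
        be named once and for all.\<close>
      have uniq: "y' = y" if "holds s 2 (tab_addr n js) y'" for y' using that y by (auto simp: holds_def)
      have upd: "?F s'" if "\<And>P. P \<noteq> tab_addr n js \<Longrightarrow> imem s' 2 P = imem s 2 P \<and> rmem s' 2 P = rmem s 2 P"
        "holds s' 2 (tab_addr n js) (min y ?V)" for s'
        unfolding touched_Suc[OF ks r] js_def[symmetric]
        by (rule updated_insert[OF I js that(1)]) (use that(2) uniq in auto)
      have bg: "bval s g \<longleftrightarrow> ?V \<noteq> \<infinity> \<and> (y = \<infinity> \<or> ?V < y)"
        using y h7 vA vA' by (auto simp: g_def holds_def)
      show "runs B (Cond g (Seq (IStore 2 A' (IConst 0)) (RStore 2 A' (RLoad 7 A))) Skip) s 3 ?F"
      proof (rule runs_Cond[where K = 2])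
        show "bok B s g" by (rule ok(3)) (use te sz' fl vA vA' in \<open>simp_all add: g_def\<close>)
        show "runs B Skip s 2 ?F" if "\<not> bval s g"
          using that bg y by (intro runs_Skip upd) (auto simp: min_def)
        assume g: "bval s g"
        then have V: "min y ?V = ?V" "imem s 7 (tab_addr size ks) = 0" "?V = ereal (rmem s 7 (tab_addr size ks))"
          using bg h7 by (auto simp: holds_def min_def)
        define s1 where "s1 = istore 2 (tab_addr n js) 0 s"
        have s1: "stage c s1" "imem s1 4 0 = int u"
          using stage_istore[OF s] B1 u by (auto simp: s1_def istore_def)
        note ev1 = ival_stage[OF s1(1)]
        have alpha1: "ival s1 (IAdd (startE m) NE) = start c + int N" "ibd M s1 (IAdd (startE m) NE)" using ev1 by simp_all
        note te10 = tuple_eval[OF s1 u(2) alpha1, folded es_def, folded A_def]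
        note te1 = te10(1-4) te10(5)[where p = p, folded A'_def] te10(6,7) te10(8)[where p = p, folded A'_def]
        show "runs B (Seq (IStore 2 A' (IConst 0)) (RStore 2 A' (RLoad 7 A))) s 2 ?F"
        proof (rule runs_Seq[where R = "\<lambda>s'. s' = s1"])
          show "runs B (IStore 2 A' (IConst 0)) s 1 (\<lambda>s'. s' = s1)"
          proof (rule runs_IStore)
            show "iok B s A'" "iok B s (IConst 0)" using te sz' by (intro ok; simp)+
          qed (simp_all add: s1_def vA')
          fix s' assume s': "s' = s1"
          show "runs B (RStore 2 A' (RLoad 7 A)) s' 1 ?F" unfolding s'
          proof (rule runs_RStore)
            show "iok B s1 A'" "rok B s1 (RLoad 7 A)" using te1 sz' by (intro ok; simp)+
            have "ival s1 A' = tab_addr n js" "rval s1 (RLoad 7 A) = rmem s 7 (tab_addr size ks)"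
              using te1(6)[OF ks(2)] te1(8)[OF ks(2) r] by (simp_all add: s1_def istore_def js_def)
            then show "?F (rstore 2 (ival s1 A') (rval s1 (RLoad 7 A)) s1)"
              by (intro upd) (use V in \<open>auto simp: s1_def istore_def rstore_def holds_def\<close>)
          qed simp
        qed simp
      qed simp
    qed simp
  qed simp
qed

lemma out_com_runs:
  assumes s: "stage c s" and p: "p \<le> m" and U: "int (size ^ (m - 1) * N) \<le> M"
    and sz: "csz (out_com m p) \<le> K"
    and H: "\<forall>ks\<in>fix_out_band c. holds s 7 (tab_addr size ks) (fix_value p c ks)"
    and acc: "\<forall>js\<in>out_band. holds s 2 (tab_addr n js) (acc js)"
  shows "runs B (out_com m p) s (2 + real (size ^ (m - 1) * N) * 7) (updated p {js \<in> out_band. js ! p = c} acc)"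
proof -
  let ?I = "\<lambda>u. updated p (touched p c u) acc"
  let ?U = "size ^ (m - 1) * N"
  have mods: "mods (out_body m p) = {2}" by (simp add: out_body_def Let_def)
  have "runs B (out_com m p) s (2 + real ?U * 7)
    (\<lambda>s'. ?I ?U s' \<and> words B s' \<and> agree (insert 4 (mods (out_body m p))) s s')"
    unfolding out_com_def
  proof (rule runs_For[where K = 5 and I = ?I and U = ?U]; (unfold mods)?)
    show "words B s" using s by (simp add: stage_def)
    show "ival s' (IMul (powE (sizeE m) (m - 1)) NE) = int ?U \<and> iok B s' (IMul (powE (sizeE m) (m - 1)) NE)"
      if "agree {4, 2} s s'" for s'
    proof -
      have "static_input (m + 1) d n N a x T s'" using static_input_agree[OF that] s by (simp add: stage_def)
      moreover have "isz (IMul (powE (sizeE m) (m - 1)) NE) \<le> K"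
        using sz by (auto simp: out_com_def For_def)
      ultimately show ?thesis using ival_count ok(1) by blast
    qed
    show "?I 0 s" using acc by (simp add: updated_def touched_def)
    show "?I u (istore 4 0 v s')" if "?I u s'" for u v s' using that by (simp add: updated_def)
  next
    fix u s' assume *: "u < ?U" "?I u s'" "words B s'" "imem s' 4 0 = int u" "agree {4, 2} s s'"
    have "int u \<le> M" using *(1) U by linarith
    moreover have "\<forall>ks\<in>fix_out_band c. holds s' 7 (tab_addr size ks) (fix_value p c ks)"
      using H *(5) by (simp add: holds_def agree_def)
    ultimately show "runs B (out_body m p) s' 5 (?I (Suc u))"
      using * sz p stage_agree[OF s *(5,3)] by (intro out_body_step) (auto simp: out_com_def For_def)
  qed (use B1 U MB in auto)
  then show ?thesis
  proof (rule runs_mono)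
    fix s' assume *: "?I ?U s' \<and> words B s' \<and> agree (insert 4 (mods (out_body m p))) s s'"
    have "c \<in> {1..n}" using s by (simp add: stage_def)
    then show "updated p {js \<in> out_band. js ! p = c} acc s'" using * touched_all[OF p] by simp
  qed simp
qed

section \<open>Parameters and the call of the given program\<close>

lemma par_com_runs:
  assumes s: "stage c s" and sz: "csz (par_com m) \<le> K"
  shows "runs B (par_com m) s 3 (\<lambda>s'. imem s' 5 0 = int size \<and> imem s' 5 1 = int N \<and> imem s' 5 2 = start c \<and>
    rmem s' = rmem s \<and> imem s' 6 = imem s 6 \<and> agree {5} s s' \<and> words B s')"
proof -
  have sz': "isz (sizeE m) \<le> K" "isz NE \<le> K" "isz (startE m) \<le> K" "isz (IConst 0) \<le> K" "isz (IConst 1) \<le> K" "isz (IConst 2) \<le> K"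
    using sz by (auto simp: par_com_def)
  define s1 where "s1 = istore 5 0 (int size) s"
  define s2 where "s2 = istore 5 1 (int N) s1"
  define s3 where "s3 = istore 5 2 (start c) s2"
  have o0: "iok B s (sizeE m)" "iok B s (IConst 0)" using ival_stage[OF s] sz' by (intro ok; simp)+
  \<comment> \<open>An expression that passes the word check has a value that is a word, so storing
    it preserves \<open>stage\<close>.\<close>
  have "\<bar>int size\<bar> \<le> B" using iok_ival_le[OF o0(1)] ival_stage[OF s] by simp
  then have s1: "stage c s1" using stage_istore[OF s] by (simp add: s1_def)
  have o1: "iok B s1 NE" "iok B s1 (IConst 1)" using ival_stage[OF s1] sz' by (intro ok; simp)+
  have "\<bar>int N\<bar> \<le> B" using iok_ival_le[OF o1(1)] ival_stage[OF s1] by simp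
  then have s2: "stage c s2" using stage_istore[OF s1] by (simp add: s2_def)
  have o2: "iok B s2 (startE m)" "iok B s2 (IConst 2)" using ival_stage[OF s2] sz' by (intro ok; simp)+
  have "\<bar>start c\<bar> \<le> B" using iok_ival_le[OF o2(1)] ival_stage[OF s2] by simp
  then have s3: "stage c s3" using stage_istore[OF s2] by (simp add: s3_def)
  have "runs B (par_com m) s 3 (\<lambda>s'. s' = s3)" unfolding par_com_def
  proof (rule runs_Seq[where R = "\<lambda>s'. s' = s1"])
    show "runs B (IStore 5 (IConst 0) (sizeE m)) s 1 (\<lambda>s'. s' = s1)"
      using o0 ival_stage[OF s] by (intro runs_IStore) (auto simp: s1_def)
    fix s' assume s': "s' = s1"
    show "runs B (Seq (IStore 5 (IConst 1) NE) (IStore 5 (IConst 2) (startE m))) s' 2 (\<lambda>s'. s' = s3)" unfolding s'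
    proof (rule runs_Seq[where R = "\<lambda>s'. s' = s2"])
      show "runs B (IStore 5 (IConst 1) NE) s1 1 (\<lambda>s'. s' = s2)"
        using o1 ival_stage[OF s1] by (intro runs_IStore) (auto simp: s2_def)
      fix s' assume "s' = s2"
      then show "runs B (IStore 5 (IConst 2) (startE m)) s' 1 (\<lambda>s'. s' = s3)"
        using o2 ival_stage[OF s2] by (intro runs_IStore) (auto simp: s3_def)
    qed simp
  qed simp
  then show ?thesis
    by (rule runs_mono) (use s3 in \<open>auto simp: s1_def s2_def s3_def istore_def agree_def stage_def\<close>)
qed

text \<open>All that is used about the given program: correctness in time \<open>R\<close> on the
  instances that actually arise, from any memory of words. The larger loops are analysed with
  \<open>R\<close> left abstract.\<close>

definition calls :: "com \<Rightarrow> real \<Rightarrow> bool" where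
  "calls P R \<longleftrightarrow> (\<forall>c\<in>{1..n}. \<forall>p\<le>m. \<forall>s. words B s \<longrightarrow>
    static_input m d size N (start c) (fixx p c n (off c) x) (fixT p c n (off c) T) s \<longrightarrow>
    runs B P s R (static_output m size N (start c) (fixw p c n (off c) w) (fixT p c n (off c) T)))"

lemma call_runs:
  assumes P: "calls P R" and s: "stage c s" and p: "p \<le> m"
    and I: "static_input m d size N (start c) (fixx p c n (off c) x) (fixT p c n (off c) T) (upper 5 s)"
  shows "runs B (cren 5 P) s R (\<lambda>s'. (\<forall>ks\<in>fix_out_band c. holds s' 7 (tab_addr size ks) (fix_value p c ks))
    \<and> words B s' \<and> agree {5..} s s')"
proof -
  have w: "words B s" "c \<in> {1..n}" using s by (simp_all add: stage_def)
  then have "words B (upper 5 s)" by (simp add: words_def)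
  then have "runs B P (upper 5 s) R (static_output m size N (start c) (fixw p c n (off c) w) (fixT p c n (off c) T))"
    using P p I w unfolding calls_def by blast
  then obtain t s1 where 1: "exec B P (upper 5 s) t s1" "real t \<le> R"
    "static_output m size N (start c) (fixw p c n (off c) w) (fixT p c n (off c) T) s1"
    unfolding runs_def by blast
  obtain s' where s': "exec B (cren 5 P) s t s'" "s1 = upper 5 s'" using exec_cren[OF 1(1) refl] by blast
  have "agree {5..} s s'" using exec_agree[OF s'(1)] mods_cren[of _ 5 P] by (auto simp: agree_def)
  moreover have "\<forall>ks\<in>fix_out_band c. holds s' 7 (tab_addr size ks) (fix_value p c ks)"
    using 1(3) unfolding s'(2) static_output_def holds_def by simp
  ultimately show ?thesis using exec_words[OF s'(1) w(1)] s'(1) 1(2) unfolding runs_def by blast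
qed

section \<open>Composing one round, a phase and the whole program\<close>

lemma step_com_runs:
  assumes P: "calls P R" and s: "stage c s" and p: "p = 0 \<or> p = m"
    and U: "int (size ^ (m - 1) * N) \<le> M" and V: "int (m * (m + 1) * d * (size + 1)) \<le> M"
    and sz: "csz (step_com P m d p) \<le> K"
    and acc: "\<forall>js\<in>out_band. holds s 2 (tab_addr n js) (acc js)"
  shows "runs B (step_com P m d p) s
    (9 + 5 * real (m * (m + 1) * d * (size + 1)) + 13 * real (size ^ (m - 1) * N) + R)
    (updated p {js \<in> out_band. js ! p = c} acc)"
proof -
  let ?V = "real (m * (m + 1) * d * (size + 1))" and ?U = "real (size ^ (m - 1) * N)"
  let ?post = "updated p {js \<in> out_band. js ! p = c} acc"
  have pm: "p \<le> m" using p by auto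
  have sz': "csz (vec_com m d p) \<le> K" "csz (tab_com m p) \<le> K" "csz (par_com m) \<le> K" "csz (out_com m p) \<le> K"
    using sz by (simp_all add: step_com_def)
  have acc': "\<forall>js\<in>out_band. holds s' 2 (tab_addr n js) (acc js)" if "agree X s s'" "2 \<notin> X" for X s'
    using acc that by (simp add: holds_def agree_def)
  show ?thesis unfolding step_com_def
  proof (rule runs_Seq[OF vec_com_runs[OF s p V sz'(1)]])
    fix s1 assume 1: "(\<forall>l<m. \<forall>t<m + 1. \<forall>i\<in>{1..size}. \<forall>q<d. rmem s1 5 (vec_addr m d size l t i q) = fixx p c n (off c) x l t i q)
      \<and> words B s1 \<and> agree {4, 5} s s1"
    then have s1: "stage c s1" using stage_agree[OF s, of "{4, 5}" s1] by simp
    show "runs B (Seq (tab_com m p) (Seq (par_com m) (Seq (cren 5 P) (out_com m p)))) s1 (7 + 13 * ?U + R) ?post"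
    proof (rule runs_Seq[OF tab_com_runs[OF s1 p U sz'(2)]])
      fix s2 assume 2: "(\<forall>js\<in>in_band c. holds s2 6 (tab_addr size js) (fixT p c n (off c) T js))
        \<and> words B s2 \<and> agree {4, 6} s1 s2"
      then have s2: "stage c s2" using stage_agree[OF s1, of "{4, 6}" s2] by simp
      show "runs B (Seq (par_com m) (Seq (cren 5 P) (out_com m p))) s2 (5 + 7 * ?U + R) ?post"
      proof (rule runs_Seq[OF par_com_runs[OF s2 sz'(3)]])
        fix s3 assume 3: "imem s3 5 0 = int size \<and> imem s3 5 1 = int N \<and> imem s3 5 2 = start c \<and>
          rmem s3 = rmem s2 \<and> imem s3 6 = imem s2 6 \<and> agree {5} s2 s3 \<and> words B s3"
        then have s3: "stage c s3" using stage_agree[OF s2, of "{5}" s3] by auto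
        have a3: "agree {4..} s s3"
          using 1 2 3 by (auto simp: agree_def)
        have "rmem s3 5 = rmem s1 5" using 2 3 by (simp add: agree_def)
        then have I: "static_input m d size N (start c) (fixx p c n (off c) x) (fixT p c n (off c) T) (upper 5 s3)"
          unfolding static_input_def holds_def upper_sel using 1 2 3 by (simp add: holds_def)
        show "runs B (Seq (cren 5 P) (out_com m p)) s3 (2 + 7 * ?U + R) ?post"
        proof (rule runs_Seq[OF call_runs[OF P s3 pm I]])
          fix s4 assume 4: "(\<forall>ks\<in>fix_out_band c. holds s4 7 (tab_addr size ks) (fix_value p c ks))
            \<and> words B s4 \<and> agree {5..} s3 s4"
          then have s4: "stage c s4" using stage_agree[OF s3, of "{5..}" s4] by auto
          have "agree {4..} s s4" using agree_trans[OF a3, of "{5..}" s4 "{4..}"] 4 by auto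
          then have "\<forall>js\<in>out_band. holds s4 2 (tab_addr n js) (acc js)" by (rule acc') simp
          then show "runs B (out_com m p) s4 (2 + ?U * 7) ?post"
            using 4 s4 pm U sz'(4) by (intro out_com_runs) auto
        qed simp
      qed simp
    qed simp
  qed simp
qed

lemma phase_com_runs:
  assumes P: "calls P R" and s: "static_input (m + 1) d n N a x T s" "words B s" and p: "p = 0 \<or> p = m"
    and U: "int (size ^ (m - 1) * N) \<le> M" and V: "int (m * (m + 1) * d * (size + 1)) \<le> M"
    and sz: "csz (phase_com P m d p) \<le> K"
    and acc: "\<forall>js\<in>out_band. holds s 2 (tab_addr n js) (acc js)"
  shows "runs B (phase_com P m d p) s
    (2 + real n * (11 + 5 * real (m * (m + 1) * d * (size + 1)) + 13 * real (size ^ (m - 1) * N) + R))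
    (\<lambda>s'. (\<forall>js\<in>out_band. holds s' 2 (tab_addr n js) (min (acc js) (part_value p m n N a w T js)))
      \<and> words B s' \<and> static_input (m + 1) d n N a x T s')"
proof -
  let ?S = "9 + 5 * real (m * (m + 1) * d * (size + 1)) + 13 * real (size ^ (m - 1) * N) + R"
  \<comment> \<open>After \<open>u\<close> rounds exactly the entries with coordinate
    \<open>p\<close> at most \<open>u\<close> have been minimised. Coordinates lie in 1, ..., n, so
    this means none before the loop and all after it.\<close>
  let ?acc = "\<lambda>u js. if js ! p \<le> u then min (acc js) (part_value p m n N a w T js) else acc js"
  let ?I = "\<lambda>u s'. \<forall>js\<in>out_band. holds s' 2 (tab_addr n js) (?acc u js)"
  \<comment> \<open>A round changes neither the input arrays 0 and 1 nor the counter in array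
    3.\<close>
  have mods: "mods (step_com P m d p) \<subseteq> {2} \<union> {4..}"
    by (auto simp: step_com_def vec_com_def tab_com_def par_com_def out_com_def
        vec_body_def tab_body_def out_body_def Let_def dest: mods_cren[of _ 5 P])
  have in1: "static_input (m + 1) d n N a x T s'" if "agree (insert 3 (mods (step_com P m d p))) s s'" for s'
    by (rule static_input_agree[OF that _ _ s(1)]) (use mods in force)+
  have nth: "1 \<le> js ! p \<and> js ! p \<le> n" if "js \<in> out_band" for js
  proof -
    have "js ! p \<in> set js" using that p by (auto simp: band_def cube_def)
    then show ?thesis using that by (auto simp: band_def cube_def)
  qed
  have "runs B (phase_com P m d p) s (2 + real n * (?S + 2))
    (\<lambda>s'. ?I n s' \<and> words B s' \<and> agree (insert 3 (mods (step_com P m d p))) s s')"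
    unfolding phase_com_def
  proof (rule runs_For[where K = ?S and I = ?I and U = n])
    show "3 \<notin> mods (step_com P m d p)" using mods by auto
    show "ival s' nE = int n \<and> iok B s' nE" if "agree (insert 3 (mods (step_com P m d p))) s s'" for s'
      using ival_input[OF in1[OF that]] sz by (auto simp: phase_com_def For_def intro!: ok)
    show "?I 0 s" using acc nth by fastforce
    show "?I u (istore 3 0 v s')" if "?I u s'" for u v s' using that by simp
  next
    fix u s' assume *: "u < n" "?I u s'" "words B s'" "imem s' 3 0 = int u"
      "agree (insert 3 (mods (step_com P m d p))) s s'"
    have st: "stage (Suc u) s'" using * in1[OF *(5)] by (simp add: stage_def)
    have "runs B (step_com P m d p) s' ?S (updated p {js \<in> out_band. js ! p = Suc u} (?acc u))"
      by (rule step_com_runs[OF P st p U V _ *(2)]) (use sz in \<open>simp add: phase_com_def For_def\<close>)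
    then show "runs B (step_com P m d p) s' ?S (?I (Suc u))"
    proof (rule runs_mono)
      fix s1 assume u: "updated p {js \<in> out_band. js ! p = Suc u} (?acc u) s1"
      show "?I (Suc u) s1"
      proof
        fix js assume js: "js \<in> out_band"
        have "(if js \<in> {js \<in> out_band. js ! p = Suc u} then min (?acc u js) (part_value p m n N a w T js) else ?acc u js)
          = ?acc (Suc u) js" using js by (auto simp: le_Suc_eq)
        moreover note u[unfolded updated_def, rule_format, OF js]
        ultimately show "holds s1 2 (tab_addr n js) (?acc (Suc u) js)" by (simp only:)
      qed
    qed simp
  qed (use s B1 nM MB in auto)
  then show ?thesis
  proof (rule runs_mono)
    fix s' assume *: "?I n s' \<and> words B s' \<and> agree (insert 3 (mods (step_com P m d p))) s s'"
    then show "(\<forall>js\<in>out_band. holds s' 2 (tab_addr n js) (min (acc js) (part_value p m n N a w T js)))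
      \<and> words B s' \<and> static_input (m + 1) d n N a x T s'"
      using in1 nth by fastforce
  qed (simp add: algebra_simps)
qed

lemma main_com_runs:
  assumes P: "calls P R" and s: "static_input (m + 1) d n N a x T s" "words B s"
    and W: "int (n ^ m * N) \<le> M" and U: "int (size ^ (m - 1) * N) \<le> M" and V: "int (m * (m + 1) * d * (size + 1)) \<le> M"
    and sz: "csz (main_com P m d) \<le> K"
  shows "runs B (main_com P m d) s
    (6 + 4 * real (n ^ m * N) + 2 * real n * (11 + 5 * real (m * (m + 1) * d * (size + 1)) + 13 * real (size ^ (m - 1) * N) + R))
    (static_output (m + 1) n N a w T)"
proof -
  let ?S = "11 + 5 * real (m * (m + 1) * d * (size + 1)) + 13 * real (size ^ (m - 1) * N) + R"
  have sz': "csz (init_com (m + 1)) \<le> K" "csz (phase_com P m d m) \<le> K" "csz (phase_com P m d 0) \<le> K"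
    using sz by (simp_all add: main_com_def)
  show ?thesis unfolding main_com_def
  proof (rule runs_Seq[OF init_com_runs[OF s W sz'(1)]])
    fix s1 assume 1: "(\<forall>js\<in>out_band. holds s1 2 (tab_addr n js) \<infinity>) \<and> words B s1 \<and> agree {2, 4} s s1"
    then have s1: "static_input (m + 1) d n N a x T s1" "words B s1" "\<forall>js\<in>out_band. holds s1 2 (tab_addr n js) \<infinity>"
      using static_input_agree[of "{2, 4}" s s1] s by auto
    show "runs B (Seq (phase_com P m d m) (phase_com P m d 0)) s1 (4 + 2 * real n * ?S) (static_output (m + 1) n N a w T)"
    proof (rule runs_Seq[OF phase_com_runs[OF P s1(1,2) _ U V sz'(2) s1(3)]])
      fix s2 assume 2: "(\<forall>js\<in>out_band. holds s2 2 (tab_addr n js) (min \<infinity> (part_value m m n N a w T js)))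
        \<and> words B s2 \<and> static_input (m + 1) d n N a x T s2"
      then have s2: "static_input (m + 1) d n N a x T s2" "words B s2"
        "\<forall>js\<in>out_band. holds s2 2 (tab_addr n js) (min \<infinity> (part_value m m n N a w T js))" by auto
      show "runs B (phase_com P m d 0) s2 (2 + real n * ?S) (static_output (m + 1) n N a w T)"
      proof (rule runs_mono[OF phase_com_runs[OF P s2(1,2) _ U V sz'(3) s2(3)]])
        fix s3 assume "(\<forall>js\<in>out_band. holds s3 2 (tab_addr n js)
            (min (min \<infinity> (part_value m m n N a w T js)) (part_value 0 m n N a w T js)))
          \<and> words B s3 \<and> static_input (m + 1) d n N a x T s3"
        \<comment> \<open>Initial infinity is neutral, and the two phases together cover all
          directions.\<close>
        moreover have "min (min \<infinity> (part_value m m n N a w T js)) (part_value 0 m n N a w T js) =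
            static_value (m + 1) n N a w T js" if "js \<in> out_band" for js
          using part_values[OF m, of js n N a w T] that by (simp add: band_def cube_def min_def)
        ultimately show "static_output (m + 1) n N a w T s3" unfolding static_output_def by metis
      qed auto
    qed auto
  qed simp
qed

section \<open>Bounds on time and word length\<close>

lemma size_pow: "size ^ (m - 1) = n ^ (m - 1)"
  by (cases "m = 1") (simp_all add: size_def)

text \<open>Writing the vectors takes time proportional to \<open>size + 1\<close>. For m = 1 this
  is 2N + 1 \<le> 3N; for larger m one factor n of \<open>n ^ (m - 1)\<close> already pays for
  it.\<close>

lemma size_le: "size + 1 \<le> 3 * (N * n ^ (m - 1))"
proof (cases "m = 1")
  case True
  then have eq: "size = 2 * N" "n ^ (m - 1) = 1" unfolding size_def by simp_all
  show ?thesis unfolding eq using N1 by simp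
next
  case False
  then have eq: "size = n" "m - 1 = Suc (m - 2)" using m by (simp_all add: size_def)
  have "n * 1 \<le> n * n ^ (m - 2)" using n1 by (intro mult_le_mono2) (simp add: one_le_power)
  then have "n \<le> n ^ (m - 1)" unfolding eq(2) by simp
  moreover have "1 * n ^ (m - 1) \<le> N * n ^ (m - 1)" using N1 by (intro mult_le_mono1)
  ultimately show ?thesis unfolding eq(1) using n1 by linarith
qed

text \<open>The start of a band is 1 after the shift and a - c without it, so all parameters of a
  call are linear in those of the original instance. Squaring absorbs the factor 3, since the base
  is at least 4; for words this just doubles the exponent.\<close>

lemma bound_le: "c \<in> {1..n} \<Longrightarrow> int size + int N + \<bar>start c\<bar> + 2 \<le> (int n + int N + \<bar>a\<bar> + 2) ^ 2"
proof -
  assume c: "c \<in> {1..n}"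
  let ?b = "int n + int N + \<bar>a\<bar> + 2"
  have "int size \<le> int n + 2 * int N" by (simp add: size_def)
  moreover have "\<bar>start c\<bar> \<le> \<bar>a\<bar> + int n + 1" using c by (auto simp: start_def off_def)
  ultimately have "int size + int N + \<bar>start c\<bar> + 2 \<le> 3 * ?b" by simp
  also have "\<dots> \<le> ?b * ?b" using n1 N1 by (intro mult_right_mono) auto
  finally show ?thesis by (simp add: power2_eq_square)
qed

lemma calls_if_solves:
  assumes P: "\<forall>n N a w x T B s. static_instance m d n N a w x T \<longrightarrow>
      (int n + int N + \<bar>a\<bar> + 2) ^ e \<le> B \<longrightarrow> (\<forall>r i. \<bar>imem s r i\<bar> \<le> B) \<longrightarrow>
      static_input m d n N a x T s \<longrightarrow>
      (\<exists>t s'. exec B P s t s' \<and> static_output m n N a w T s' \<and> real t \<le> C * f n N)"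
    and B: "(int n + int N + \<bar>a\<bar> + 2) ^ (2 * e) \<le> B"
  shows "calls P (C * f size N)"
  unfolding calls_def runs_def
proof (intro ballI allI impI)
  fix c p s assume c: "c \<in> {1..n}" and p: "p \<le> m" and w: "words B s"
    and I: "static_input m d size N (start c) (fixx p c n (off c) x) (fixT p c n (off c) T) s"
  have "static_instance m d size N (start c) (fixw p c n (off c) w) (fixx p c n (off c) x) (fixT p c n (off c) T)"
    unfolding start_def by (rule fix_instance[OF inst p c size1])
  moreover have "(int size + int N + \<bar>start c\<bar> + 2) ^ e \<le> B"
  proof -
    have "(int size + int N + \<bar>start c\<bar> + 2) ^ e \<le> ((int n + int N + \<bar>a\<bar> + 2) ^ 2) ^ e"
      by (rule power_mono[OF bound_le[OF c]]) simp
    then show ?thesis using B by (simp add: power_mult[symmetric])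
  qed
  ultimately show "\<exists>t s'. exec B P s t s' \<and> real t \<le> C * f size N \<and>
      static_output m size N (start c) (fixw p c n (off c) w) (fixT p c n (off c) T) s'"
    using P w I unfolding words_def by meson
qed

text \<open>Here \<open>y\<close> and \<open>z\<close> stand for the powers of N with exponents 2 -
  \<epsilon> and 2 - \<delta>. Every cost per call is compared with n ^ (m - 1) * z: 24 = 11 + 13
  and 15 = 5 * 3, and then 58 = 6 + 4 + 2 * 24 and 30 = 2 * 15. The sign of \<open>C\<close> is not
  known, hence its absolute value.\<close>

lemma time_bound:
  fixes y z C :: real
  assumes y: "y \<le> z" "real N \<le> z" "0 \<le> y"
  shows "6 + 4 * real (n ^ m * N) + 2 * real n * (11 + 5 * real (m * (m + 1) * d * (size + 1)) +
      13 * real (size ^ (m - 1) * N) + C * (y * real size ^ (m - 1)))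
    \<le> (58 + 30 * real (m * (m + 1) * d) + 2 * \<bar>C\<bar>) * (z * real n ^ m)"
proof -
  define G where "G = real n ^ (m - 1)"
  define D where "D = real (m * (m + 1) * d)"
  have G: "1 \<le> G" using n1 by (simp add: G_def one_le_power)
  have nG: "real n ^ m = real n * G" unfolding G_def by (metis m power_eq_if not_one_le_zero)
  have z: "1 \<le> z" using y N1 by linarith
  have X: "1 \<le> G * z" using mult_mono[OF G z] G by simp
  have NG: "real N * G \<le> G * z" using mult_left_mono[OF y(2), of G] G by (simp add: mult.commute)
  have "real (size + 1) \<le> real (3 * (N * n ^ (m - 1)))" using size_le by (simp only: of_nat_le_iff)
  then have "real (size + 1) \<le> 3 * (G * z)" using NG by (simp add: G_def)
  then have "D * real (size + 1) \<le> D * (3 * (G * z))" by (rule mult_left_mono) (simp add: D_def)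
  also have "D * (3 * (G * z)) = 3 * (D * (G * z))" by simp
  finally have "real (m * (m + 1) * d * (size + 1)) \<le> 3 * (D * (G * z))" unfolding D_def by (simp only: of_nat_mult)
  then have 1: "5 * real (m * (m + 1) * d * (size + 1)) \<le> 15 * D * (G * z)" by linarith
  have sG: "real size ^ (m - 1) = G" using size_pow unfolding G_def by (metis of_nat_power)
  have 2: "13 * real (size ^ (m - 1) * N) \<le> 13 * (G * z)" unfolding size_pow using NG by (simp add: G_def mult.commute)
  have "y * G \<le> z * G" using y(1) G by (intro mult_right_mono) auto
  then have "\<bar>C\<bar> * (y * G) \<le> \<bar>C\<bar> * (G * z)" by (intro mult_left_mono) (auto simp: mult.commute)
  moreover have "C * (y * G) \<le> \<bar>C\<bar> * (y * G)" using y(3) G by (intro mult_right_mono) auto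
  ultimately have 3: "C * (y * real size ^ (m - 1)) \<le> \<bar>C\<bar> * (G * z)" unfolding sG by linarith
  have "11 + 5 * real (m * (m + 1) * d * (size + 1)) + 13 * real (size ^ (m - 1) * N) + C * (y * real size ^ (m - 1))
      \<le> (24 + 15 * D + \<bar>C\<bar>) * (G * z)"
    using X 1 2 3 by (simp add: distrib_right)
  then have 4: "2 * real n * (11 + 5 * real (m * (m + 1) * d * (size + 1)) + 13 * real (size ^ (m - 1) * N) + C * (y * real size ^ (m - 1)))
      \<le> 2 * real n * ((24 + 15 * D + \<bar>C\<bar>) * (G * z))"
    by (rule mult_left_mono) simp
  have "real (n ^ m * N) = real n * (real N * G)" using nG by simp
  also have "\<dots> \<le> real n * (G * z)" using NG by (intro mult_left_mono) auto
  finally have 5: "4 * real (n ^ m * N) \<le> 4 * (real n * (G * z))" by simp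
  have "1 * 1 \<le> real n * (G * z)" using X n1 by (intro mult_mono) auto
  then have 6: "6 \<le> 6 * (real n * (G * z))" by simp
  have "6 * (real n * (G * z)) + 4 * (real n * (G * z)) + 2 * real n * ((24 + 15 * D + \<bar>C\<bar>) * (G * z))
      = (58 + 30 * D + 2 * \<bar>C\<bar>) * (z * real n ^ m)"
    unfolding nG by (simp add: algebra_simps)
  then show ?thesis using 4 5 6 unfolding D_def by linarith
qed

end

lemma solves_main_com:
  assumes m: "1 \<le> m" and d: "1 \<le> d" and \<delta>: "\<delta> \<le> \<epsilon>" "\<delta> \<le> 1"
    and P: "solves_static m d P (\<lambda>n N. real N powr (2 - \<epsilon>) * real n ^ (m - 1))"
  shows "solves_static (m + 1) d (main_com P m d) (\<lambda>n N. real N powr (2 - \<delta>) * real n ^ m)"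
proof -
  obtain e C where P': "\<forall>n N a w x T B s. static_instance m d n N a w x T \<longrightarrow>
      (int n + int N + \<bar>a\<bar> + 2) ^ e \<le> B \<longrightarrow> (\<forall>r i. \<bar>imem s r i\<bar> \<le> B) \<longrightarrow>
      static_input m d n N a x T s \<longrightarrow>
      (\<exists>t s'. exec B P s t s' \<and> static_output m n N a w T s' \<and>
        real t \<le> C * (real N powr (2 - \<epsilon>) * real n ^ (m - 1)))"
    using P unfolding solves_static_def by blast
  \<comment> \<open>The 1 makes \<open>K\<close> positive, so that \<open>M ^ K \<le> B\<close> also
    gives \<open>M \<le> B\<close>.\<close>
  define K where "K = csz (main_com P m d) + 1"
  define D where "D = m * (m + 1) * d"
  \<comment> \<open>With b = n + N + |a| + 2, the power \<open>b ^ E\<close> must bound all loop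
    lengths: n ^ m * N needs exponent m + 1, and D * (size + 1) needs D + 2 because D < 2 ^ D and
    size + 1 \<le> 2 * b.\<close>
  define E where "E = m + D + 2"
  show ?thesis unfolding solves_static_def
  \<comment> \<open>In the word exponent, E * K serves the reduction's own expressions and 2 * e the
    calls.\<close>
  proof (rule exI[of _ "E * K + 2 * e"], rule exI[of _ "58 + 30 * real D + 2 * \<bar>C\<bar>"], intro allI impI)
    fix n N a w x T B s
    assume I: "static_instance (m + 1) d n N a w x T" and B: "(int n + int N + \<bar>a\<bar> + 2) ^ (E * K + 2 * e) \<le> B"
      and w: "\<forall>r i. \<bar>imem s r i\<bar> \<le> B" and s: "static_input (m + 1) d n N a x T s"
    define b where "b = int n + int N + \<bar>a\<bar> + 2"
    define M where "M = b ^ E"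
    have nN: "1 \<le> n" "1 \<le> N" using I by (auto simp: static_instance_def)
    then have b: "4 \<le> b" "int n \<le> b" "int N \<le> b" "\<bar>a\<bar> \<le> b" "2 \<le> b" by (simp_all add: b_def)
    have pw: "b ^ i \<le> b ^ j" if "i \<le> j" for i j using b that by (intro power_increasing) auto
    have bM: "b \<le> M" using pw[of 1 E] by (simp add: M_def E_def)
    have MK: "M ^ K \<le> B"
      unfolding M_def power_mult[symmetric] by (rule order_trans[OF pw B[folded b_def]]) simp
    have be: "b ^ (2 * e) \<le> B" by (rule order_trans[OF pw B[folded b_def]]) simp
    have "M ^ 1 \<le> M ^ K" using bM b by (intro power_increasing) (auto simp: K_def)
    then have MB: "M \<le> B" using MK by simp
    interpret reduction m d n N a w x T B M K
      by unfold_locales (use m d I MK MB bM b in auto)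
    have pN: "int n ^ i * int N \<le> M" if "i \<le> m" for i
    proof -
      have "int n ^ i * int N \<le> b ^ i * b" using b by (intro mult_mono power_mono) auto
      also have "\<dots> \<le> b ^ E" using pw[of "Suc i" E] that by (simp add: E_def mult.commute)
      finally show ?thesis by (simp add: M_def)
    qed
    have W: "int (n ^ m * N) \<le> M" "int (size ^ (m - 1) * N) \<le> M"
      unfolding size_pow using pN[of m] pN[of "m - 1"] by simp_all
    have V: "int (m * (m + 1) * d * (size + 1)) \<le> M"
    proof -
      have "int D \<le> 2 ^ D" using less_exp[of D] by (metis less_imp_le of_nat_le_iff of_nat_numeral of_nat_power)
      also have "\<dots> \<le> b ^ D" using b by (intro power_mono) auto
      finally have 1: "int D \<le> b ^ D" .
      have "int (size + 1) \<le> 2 * b" by (simp add: b_def size_def)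
      also have "\<dots> \<le> b * b" using b by (intro mult_right_mono) auto
      finally have "int D * int (size + 1) \<le> b ^ D * (b * b)" using 1 b by (intro mult_mono) auto
      also have "\<dots> = b ^ (D + 2)" by (simp add: power_add power2_eq_square)
      also have "\<dots> \<le> M" unfolding M_def by (rule pw) (simp add: E_def)
      finally show ?thesis by (simp only: D_def of_nat_mult)
    qed
    have calls: "calls P (C * (real N powr (2 - \<epsilon>) * real size ^ (m - 1)))"
      by (rule calls_if_solves[OF P']) (use be in \<open>simp add: b_def\<close>)
    have "words B s" using w by (simp add: words_def)
    from main_com_runs[OF calls s this W V]
    obtain t s' where t: "exec B (main_com P m d) s t s'" "static_output (m + 1) n N a w T s'"
      "real t \<le> 6 + 4 * real (n ^ m * N) + 2 * real n * (11 + 5 * real (m * (m + 1) * d * (size + 1)) +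
        13 * real (size ^ (m - 1) * N) + C * (real N powr (2 - \<epsilon>) * real size ^ (m - 1)))"
      unfolding runs_def K_def by (auto simp del: of_nat_mult of_nat_add)
    \<comment> \<open>The condition \<delta> \<le> \<epsilon> absorbs the time of the calls, and
      \<delta> \<le> 1 the overhead linear in \<open>N\<close>.\<close>
    have "real N powr (2 - \<epsilon>) \<le> real N powr (2 - \<delta>)" using nN \<delta> by (intro powr_mono) auto
    moreover have "real N \<le> real N powr (2 - \<delta>)" using nN \<delta> powr_mono[of 1 "2 - \<delta>" "real N"] by simp
    ultimately have "real t \<le> (58 + 30 * real D + 2 * \<bar>C\<bar>) * (real N powr (2 - \<delta>) * real n ^ m)"
      using order_trans[OF t(3) time_bound[of "real N powr (2 - \<epsilon>)" "real N powr (2 - \<delta>)" C]]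
      unfolding D_def by simp
    then show "\<exists>t s'. exec B (main_com P m d) s t s' \<and> static_output (m + 1) n N a w T s' \<and>
        real t \<le> (58 + 30 * real D + 2 * \<bar>C\<bar>) * (real N powr (2 - \<delta>) * real n ^ m)"
      using t by blast
  qed
qed

theorem theorem3p4:
  fixes k d :: nat
  assumes "k \<ge> 2" and "d \<ge> 1"
    and "\<exists>\<epsilon>::real. \<epsilon> > 0 \<and>
      (\<exists>P. solves_static (k - 1) d P (\<lambda>n N. real N powr (2 - \<epsilon>) * real n ^ (k - 2)))"
  shows "\<exists>\<delta>::real. \<delta> > 0 \<and>
      (\<exists>Q. solves_static k d Q (\<lambda>n N. real N powr (2 - \<delta>) * real n ^ (k - 1)))"
proof -
  obtain \<epsilon> P where e: "\<epsilon> > 0"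
    "solves_static (k - 1) d P (\<lambda>n N. real N powr (2 - \<epsilon>) * real n ^ (k - 2))" using assms(3) by blast
  have k: "k - 1 - 1 = k - 2" "k - 1 + 1 = k" "1 \<le> k - 1" using assms(1) by auto
  have "solves_static k d (main_com P (k - 1) d) (\<lambda>n N. real N powr (2 - min \<epsilon> 1) * real n ^ (k - 1))"
    using solves_main_com[of "k - 1" d "min \<epsilon> 1" \<epsilon> P] e(2) assms(2) k by simp
  then show ?thesis using e(1) by (intro exI[of _ "min \<epsilon> 1"]) auto
qed

end
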